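(* Let $(\Omega,\mathcal F)$ be a measurable space carrying a sequence of real random variables $(X_n)_{n\in\mathbb N}$, let $S_n:=\sum_{i=1}^nX_i$, and let $(\mathcal F_n)_{n\in\mathbb N_0}$ be the filtration generated by $(X_n)_{n\in\mathbb N}$. Let $q\in[1,2)$ and let $\mathcal P$ be a collection of probability measures on $(\Omega,\mathcal F)$ such that under each $\mathsf P\in\mathcal P$ the sequence $(X_n)_{n\in\mathbb N}$ is i.i.d. and integrable with $\mathsf E_{\mathsf P}[X_1]=0$. Define the event lattice $$\mathcal A_{q\text{-div}}:=\left(\bigcup_{k\ge m}\left\{\frac{|S_k|}{k^{1/q}}\ge\varepsilon\right\}\right)_{(m,\varepsilon)\in\mathbb N\times\mathbb R^+}.$$ Then the following three conditions are equivalent: (i) $X_1$ has a uniformly integrable $q$-th moment: $\lim_{x\to\infty}\sup_{\mathsf P\in\mathcal P}\mathsf E_{\mathsf P}\big[|X_1|^q\mathbf 1\{|X_1|^q\ge x\}\big]=0$. (ii) The strong law of large numbers holds uniformly in $\mathcal P$ at a rate of $o(n^{1/q-1})$: for every $\varepsilon>0$, $\lim_{m\to\infty}\sup_{\mathsf P\in\mathcal P}\mathsf P\left[\sup_{k\ge m}\frac{|S_k|}{k^{1/q}}\ge\varepsilon\right]=0$. (iii) There exists a $\mathcal P$-$e$-process that diverges pathwise to $\infty$ tail-uniformly on $\mathcal A_{q\text{-div}}$.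
   Context: $\mathbb N=\{1,2,\dots\}$, $\mathbb N_0=\{0,1,2,\dots\}$, $\mathbb R^+=(0,\infty)$. Event lattice: a collection of events $(A^{(m,\varepsilon)})_{(m,\varepsilon)\in\mathbb N\times\mathbb R^+}$ with $A^{(m_1,\varepsilon_1)}\supseteq A^{(m_2,\varepsilon_2)}$ whenever $m_1\le m_2$ and $\varepsilon_1\le\varepsilon_2$. $e$-process: a nonnegative $(\mathcal F_n)_{n\in\mathbb N_0}$-adapted process $(E_n)_{n\in\mathbb N_0}$ is a $\mathsf P$-$e$-process if $\mathsf E_{\mathsf P}[E_\tau]\le1$ for every $(\mathcal F_n)_{n\in\mathbb N_0}$-stopping time $\tau$ (possibly taking the value $\infty$), with the convention $E_\infty=\limsup_nE_n$. It is a $\mathcal P$-$e$-process if this holds for all $\mathsf P\in\mathcal P$. Tail-uniform divergence: a process $(E_n)_{n\in\mathbb N_0}$ diverges pathwise to $\infty$ tail-uniformly on an event lattice $(A^{(m,\varepsilon)})_{(m,\varepsilon)\in\mathbb N\times\mathbb R^+}$ if for all $\varepsilon>0$, $\lim_{m\to\infty}\inf_{\omega\in A^{(m,\varepsilon)}}\sup_{n\in\mathbb N}E_n(\omega)=\infty$ (with $\inf\emptyset=\infty$). *)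

theory Defs
  imports "HOL-Probability.Probability"
begin

text \<open>
  In what follows the measurable space \<open>(\<Omega>, F)\<close> is given by a measure \<open>M\<close> of which only
  \<open>space M\<close> and \<open>sets M\<close> are used. Sequences indexed by the positive integers are functions on
  \<open>nat\<close> whose value at 0 is never used.
\<close>

definition partial_sum :: "(nat \<Rightarrow> 'a \<Rightarrow> real) \<Rightarrow> nat \<Rightarrow> 'a \<Rightarrow> real" where
  "partial_sum X n \<omega> = (\<Sum>i=1..n. X i \<omega>)"

text \<open>For \<open>n = 0\<close> there are no generators and this is the trivial \<open>\<sigma>\<close>-algebra.\<close>

definition natural_filtration :: "'a measure \<Rightarrow> (nat \<Rightarrow> 'a \<Rightarrow> real) \<Rightarrow> nat \<Rightarrow> 'a measure" where
  "natural_filtration M X n =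
     sigma (space M) {X i -` B \<inter> space M | i B. i \<in> {1..n} \<and> B \<in> sets borel}"

definition iid_sequence :: "'a measure \<Rightarrow> (nat \<Rightarrow> 'a \<Rightarrow> real) \<Rightarrow> bool" where
  "iid_sequence P X \<longleftrightarrow>
     prob_space.indep_vars P (\<lambda>_. borel) X {1..} \<and>
     (\<forall>n\<ge>1. distr P borel (X n) = distr P borel (X 1))"

text \<open>The suprema over \<open>\<P>\<close> are taken in \<open>ennreal\<close>: they may be infinite and are 0 for empty \<open>\<P>\<close>.\<close>

definition uniformly_integrable_moment :: "'a measure set \<Rightarrow> real \<Rightarrow> ('a \<Rightarrow> real) \<Rightarrow> bool" where
  "uniformly_integrable_moment \<P> q Y \<longleftrightarrow>
     ((\<lambda>x::real. SUP P\<in>\<P>. \<integral>\<^sup>+\<omega>. ennreal (\<bar>Y \<omega>\<bar> powr q) * indicator {\<omega>'. \<bar>Y \<omega>'\<bar> powr q \<ge> x} \<omega> \<partial>P)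
        \<longlongrightarrow> 0) at_top"

definition uniform_SLLN :: "'a measure set \<Rightarrow> (nat \<Rightarrow> 'a \<Rightarrow> real) \<Rightarrow> real \<Rightarrow> bool" where
  "uniform_SLLN \<P> X q \<longleftrightarrow>
     (\<forall>\<epsilon>>0. (\<lambda>m::nat. SUP P\<in>\<P>. emeasure P
        {\<omega>\<in>space P. (SUP k\<in>{m..}. ereal (\<bar>partial_sum X k \<omega>\<bar> / real k powr (1 / q))) \<ge> ereal \<epsilon>})
        \<longlonglongrightarrow> 0)"

text \<open>
  A stopping time of a filtration indexed by \<open>nat\<close> that may take the value \<open>\<infinity>\<close>; the library's
  \<^const>\<open>stopping_time\<close> only has values in the index type of the filtration.
\<close>

definition extended_stopping_time :: "(nat \<Rightarrow> 'a measure) \<Rightarrow> ('a \<Rightarrow> enat) \<Rightarrow> bool" where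
  "extended_stopping_time F \<tau> \<longleftrightarrow> (\<forall>n. Measurable.pred (F n) (\<lambda>\<omega>. \<tau> \<omega> \<le> enat n))"

text \<open>The value at a random time, with the convention \<open>E\<^sub>\<infinity> = limsup E\<^sub>n\<close>, possibly infinite.\<close>

definition stopped_value :: "(nat \<Rightarrow> 'a \<Rightarrow> real) \<Rightarrow> ('a \<Rightarrow> enat) \<Rightarrow> 'a \<Rightarrow> ennreal" where
  "stopped_value E \<tau> \<omega> =
     (case \<tau> \<omega> of enat n \<Rightarrow> ennreal (E n \<omega>) | \<infinity> \<Rightarrow> limsup (\<lambda>n. ennreal (E n \<omega>)))"

definition e_process ::
  "'a measure set \<Rightarrow> (nat \<Rightarrow> 'a measure) \<Rightarrow> (nat \<Rightarrow> 'a \<Rightarrow> real) \<Rightarrow> bool" where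
  "e_process \<P> F E \<longleftrightarrow>
     (\<forall>n. E n \<in> borel_measurable (F n) \<and> (\<forall>\<omega>\<in>space (F n). 0 \<le> E n \<omega>)) \<and>
     (\<forall>P\<in>\<P>. \<forall>\<tau>. extended_stopping_time F \<tau> \<longrightarrow> (\<integral>\<^sup>+\<omega>. stopped_value E \<tau> \<omega> \<partial>P) \<le> 1)"

text \<open>
  The families below are only meant for indices \<open>m \<ge> 1\<close> and \<open>\<epsilon> > 0\<close>.
\<close>

definition event_lattice :: "'a measure \<Rightarrow> (nat \<Rightarrow> real \<Rightarrow> 'a set) \<Rightarrow> bool" where
  "event_lattice M A \<longleftrightarrow>
     (\<forall>m\<ge>1. \<forall>\<epsilon>>0. A m \<epsilon> \<in> sets M) \<and>
     (\<forall>m1\<ge>1. \<forall>m2\<ge>m1. \<forall>\<epsilon>1>0. \<forall>\<epsilon>2\<ge>\<epsilon>1. A m2 \<epsilon>2 \<subseteq> A m1 \<epsilon>1)"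

text \<open>Extended reals make \<open>INF\<close> over the empty set equal to \<open>\<infinity>\<close> and allow an infinite \<open>SUP\<close>.\<close>

definition diverges_tail_uniformly ::
  "(nat \<Rightarrow> 'a \<Rightarrow> real) \<Rightarrow> (nat \<Rightarrow> real \<Rightarrow> 'a set) \<Rightarrow> bool" where
  "diverges_tail_uniformly E A \<longleftrightarrow>
     (\<forall>\<epsilon>>0. (\<lambda>m. INF \<omega>\<in>A m \<epsilon>. SUP n\<in>{1..}. ereal (E n \<omega>)) \<longlonglongrightarrow> \<infinity>)"

definition A_qdiv ::
  "'a measure \<Rightarrow> (nat \<Rightarrow> 'a \<Rightarrow> real) \<Rightarrow> real \<Rightarrow> nat \<Rightarrow> real \<Rightarrow> 'a set" where
  "A_qdiv M X q m \<epsilon> =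
     (\<Union>k\<in>{m..}. {\<omega>\<in>space M. \<bar>partial_sum X k \<omega>\<bar> / real k powr (1 / q) \<ge> \<epsilon>})"

lemma event_lattice_A_qdiv:
  assumes "\<And>n. n \<ge> 1 \<Longrightarrow> X n \<in> borel_measurable M"
  shows "event_lattice M (A_qdiv M X q)"
proof -
  have [measurable]: "partial_sum X k \<in> borel_measurable M" for k
    unfolding partial_sum_def[abs_def] using assms by (intro borel_measurable_sum) auto
  have "A_qdiv M X q m \<epsilon> \<in> sets M" for m \<epsilon>
  proof -
    have "{\<omega>\<in>space M. \<bar>partial_sum X k \<omega>\<bar> / real k powr (1 / q) \<ge> \<epsilon>} \<in> sets M" for k
      by measurable
    then show ?thesis
      unfolding A_qdiv_def by blast
  qed
  moreover have "A_qdiv M X q m2 \<epsilon>2 \<subseteq> A_qdiv M X q m1 \<epsilon>1"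
    if "m1 \<le> m2" "\<epsilon>1 \<le> \<epsilon>2" for m1 m2 \<epsilon>1 \<epsilon>2
    unfolding A_qdiv_def using that by (blast intro: order_trans)
  ultimately show ?thesis
    unfolding event_lattice_def by blast
qed

end

theory Submission
  imports Defs
begin

text \<open>
  The theorem is a uniform version of the Marcinkiewicz--Zygmund strong law together with its
  converse, and a characterization of it by \<open>e\<close>-processes.

  From uniform integrability to the strong law, the classical proof is made quantitative, so that
  its only inputs are a bound for the \<open>q\<close>-th moments and their tails. The variables are truncated
  at the level of the normalization, \<open>\<bar>X i\<bar> powr q < i\<close>, and the sum is split at an index \<open>m\<close>. The
  probability that a truncation has an effect after \<open>m\<close>, and the means of the truncated variables,
  are controlled by \<open>tail_moment m\<close>. For the centered truncated variables, Kolmogorov's maximal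
  inequality (\<open>Kolmogorov_maximal_inequality\<close>) bounds the sums of the normalized variables, and
  Kronecker's lemma (\<open>Kronecker_bound\<close>) transfers this to the sums themselves. The variances of the
  normalized variables have a sum that is controlled by \<open>q\<close>-th moments
  (\<open>truncated_square_sum_le\<close>); this is where \<open>q < 2\<close> enters. All of this is collected in
  \<open>maximal_deviation_finite\<close>.

  For the converse, a small probability of large ratios after time \<open>m\<close> excludes, by independence,
  that the probabilities of \<open>\<bar>X 1\<bar> powr q \<ge> k\<close> for \<open>k > m\<close> have a large sum
  (\<open>tail_prob_sum_le\<close>), and this sum controls the tail of the \<open>q\<close>-th moment.

  The equivalence with the existence of an \<open>e\<close>-process rests on Markov's inequality: an
  \<open>e\<close>-process that is large on an event forces its probability to be small (\<open>Ville_bound\<close>), and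
  conversely the number of deviation events that have occurred, along events whose probabilities
  have uniformly small sum, is an \<open>e\<close>-process (\<open>diverging_e_process_if_uniform_SLLN\<close>).
\<close>

section \<open>Uniform convergence and deviation events\<close>

text \<open>
  All uniformity in \<open>P\<close> is handled in this form: the estimates below are proved for one measure,
  with constants that do not depend on it.
\<close>

lemma SUP_tendsto_0_iff:
  fixes f :: "'b \<Rightarrow> 'c \<Rightarrow> ennreal"
  shows "((\<lambda>x. SUP p\<in>S. f p x) \<longlongrightarrow> 0) F \<longleftrightarrow> (\<forall>\<delta>>0. \<forall>\<^sub>F x in F. \<forall>p\<in>S. f p x \<le> ennreal \<delta>)"
proof (intro iffI allI impI)
  fix \<delta> :: real assume "((\<lambda>x. SUP p\<in>S. f p x) \<longlongrightarrow> 0) F" "0 < \<delta>"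
  then have "\<forall>\<^sub>F x in F. (SUP p\<in>S. f p x) < ennreal \<delta>"
    by (intro order_tendstoD) auto
  then show "\<forall>\<^sub>F x in F. \<forall>p\<in>S. f p x \<le> ennreal \<delta>"
    by eventually_elim (metis SUP_lessD less_imp_le)
next
  assume *: "\<forall>\<delta>>0. \<forall>\<^sub>F x in F. \<forall>p\<in>S. f p x \<le> ennreal \<delta>"
  show "((\<lambda>x. SUP p\<in>S. f p x) \<longlongrightarrow> 0) F"
  proof (rule order_tendstoI)
    fix y :: ennreal assume "0 < y"
    then obtain z where z: "0 < z" "z < y"
      using dense by blast
    then obtain \<delta> where \<delta>: "z = ennreal \<delta>" "0 < \<delta>"
      by (cases z) auto
    with * have "\<forall>\<^sub>F x in F. \<forall>p\<in>S. f p x \<le> ennreal \<delta>"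
      by blast
    then show "\<forall>\<^sub>F x in F. (SUP p\<in>S. f p x) < y"
    proof eventually_elim
      case (elim x)
      then have "(SUP p\<in>S. f p x) \<le> ennreal \<delta>"
        by (intro SUP_least) auto
      then show ?case
        using z \<delta> by simp
    qed
  qed simp
qed

lemma A_qdiv_iff:
  "\<omega> \<in> A_qdiv M X q m \<epsilon> \<longleftrightarrow>
    \<omega> \<in> space M \<and> (\<exists>k\<ge>m. \<epsilon> \<le> \<bar>partial_sum X k \<omega>\<bar> / real k powr (1 / q))"
  by (auto simp: A_qdiv_def)

locale random_sequence_family =
  fixes M :: "'a measure" and X :: "nat \<Rightarrow> 'a \<Rightarrow> real" and \<P> :: "'a measure set"
  assumes X_measurable: "\<And>n. n \<ge> 1 \<Longrightarrow> X n \<in> borel_measurable M"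
    and prob: "\<And>P. P \<in> \<P> \<Longrightarrow> prob_space P"
    and sets: "\<And>P. P \<in> \<P> \<Longrightarrow> sets P = sets M"
begin

lemma space_eq: "P \<in> \<P> \<Longrightarrow> space P = space M"
  by (rule sets_eq_imp_space_eq[OF sets])

lemma partial_sum_measurable [measurable]: "partial_sum X k \<in> borel_measurable M"
  unfolding partial_sum_def[abs_def] using X_measurable by (intro borel_measurable_sum) auto

lemma A_qdiv_sets: "P \<in> \<P> \<Longrightarrow> A_qdiv M X q m \<epsilon> \<in> sets P"
  unfolding A_qdiv_def sets by measurable

text \<open>
  If the supremum of the ratios is \<open>\<epsilon>\<close> without being attained, then its event is larger than the
  event of the lattice with the same \<open>\<epsilon>\<close>, but it always lies inside the one with \<open>\<epsilon> / 2\<close>.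
  Since \<open>\<epsilon>\<close> is arbitrary, the two formulations agree.
\<close>

lemma uniform_SLLN_iff:
  "uniform_SLLN \<P> X q \<longleftrightarrow>
    (\<forall>\<epsilon>>0. \<forall>\<delta>>0. \<forall>\<^sub>F m in sequentially. \<forall>P\<in>\<P>. emeasure P (A_qdiv M X q m \<epsilon>) \<le> ennreal \<delta>)"
proof -
  let ?r = "\<lambda>k \<omega>. \<bar>partial_sum X k \<omega>\<bar> / real k powr (1 / q)"
  let ?B = "\<lambda>P m \<epsilon>. {\<omega>\<in>space P. ereal \<epsilon> \<le> (SUP k\<in>{m..}. ereal (?r k \<omega>))}"
  have B_sets: "?B P m \<epsilon> \<in> sets P" if P: "P \<in> \<P>" for P m \<epsilon>
  proof -
    have [measurable]: "partial_sum X k \<in> borel_measurable P" for k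
      using partial_sum_measurable measurable_cong_sets[OF sets[OF P] refl] by blast
    show ?thesis
      by measurable
  qed
  have sub1: "A_qdiv M X q m \<epsilon> \<subseteq> ?B P m \<epsilon>" if P: "P \<in> \<P>" for P m \<epsilon>
  proof
    fix \<omega> assume "\<omega> \<in> A_qdiv M X q m \<epsilon>"
    then obtain k where k: "\<omega> \<in> space M" "m \<le> k" "\<epsilon> \<le> ?r k \<omega>"
      by (auto simp: A_qdiv_iff)
    then have "ereal \<epsilon> \<le> (SUP k\<in>{m..}. ereal (?r k \<omega>))"
      by (intro SUP_upper2[of k]) auto
    with k show "\<omega> \<in> ?B P m \<epsilon>"
      using space_eq[OF P] by simp
  qed
  have sub2: "?B P m \<epsilon> \<subseteq> A_qdiv M X q m (\<epsilon> / 2)" if P: "P \<in> \<P>" and "0 < \<epsilon>" for P m \<epsilon>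
  proof
    fix \<omega> assume \<omega>: "\<omega> \<in> ?B P m \<epsilon>"
    have "ereal (\<epsilon> / 2) < ereal \<epsilon>"
      using \<open>0 < \<epsilon>\<close> by simp
    also have "\<dots> \<le> (SUP k\<in>{m..}. ereal (?r k \<omega>))"
      using \<omega> by simp
    finally obtain k where "m \<le> k" "ereal (\<epsilon> / 2) < ereal (?r k \<omega>)"
      unfolding less_SUP_iff by auto
    then show "\<omega> \<in> A_qdiv M X q m (\<epsilon> / 2)"
      using \<omega> space_eq[OF P] by (auto simp: A_qdiv_iff intro!: exI[of _ k])
  qed
  show ?thesis
    unfolding uniform_SLLN_def SUP_tendsto_0_iff
  proof (intro iffI allI impI)
    fix \<epsilon> \<delta> :: real
    assume "\<forall>\<epsilon>>0. \<forall>\<delta>>0. \<forall>\<^sub>F m in sequentially. \<forall>P\<in>\<P>. emeasure P (?B P m \<epsilon>) \<le> ennreal \<delta>"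
      and "0 < \<epsilon>" "0 < \<delta>"
    then have "\<forall>\<^sub>F m in sequentially. \<forall>P\<in>\<P>. emeasure P (?B P m \<epsilon>) \<le> ennreal \<delta>"
      by blast
    then show "\<forall>\<^sub>F m in sequentially. \<forall>P\<in>\<P>. emeasure P (A_qdiv M X q m \<epsilon>) \<le> ennreal \<delta>"
      by eventually_elim (use emeasure_mono[OF sub1 B_sets] in \<open>blast intro: order_trans\<close>)
  next
    fix \<epsilon> \<delta> :: real
    assume "\<forall>\<epsilon>>0. \<forall>\<delta>>0. \<forall>\<^sub>F m in sequentially. \<forall>P\<in>\<P>. emeasure P (A_qdiv M X q m \<epsilon>) \<le> ennreal \<delta>"
      and \<epsilon>: "0 < \<epsilon>" and \<delta>: "0 < \<delta>"
    then have "\<forall>\<^sub>F m in sequentially. \<forall>P\<in>\<P>. emeasure P (A_qdiv M X q m (\<epsilon> / 2)) \<le> ennreal \<delta>"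
      using half_gt_zero by blast
    then show "\<forall>\<^sub>F m in sequentially. \<forall>P\<in>\<P>. emeasure P (?B P m \<epsilon>) \<le> ennreal \<delta>"
      by eventually_elim (use emeasure_mono[OF sub2[OF _ \<epsilon>] A_qdiv_sets] in \<open>blast intro: order_trans\<close>)
  qed
qed

end

section \<open>Divergent e-processes\<close>

context random_sequence_family
begin

lemma sets_natural_filtration:
  "sets (natural_filtration M X n) =
    sigma_sets (space M) {X i -` B \<inter> space M | i B. i \<in> {1..n} \<and> B \<in> sets borel}"
  unfolding natural_filtration_def by (rule sets_measure_of) auto

lemma space_natural_filtration [simp]: "space (natural_filtration M X n) = space M"
  unfolding natural_filtration_def by (rule space_measure_of) auto

lemma subalgebra_natural_filtration:
  assumes "k \<le> n"
  shows "subalgebra (natural_filtration M X n) (natural_filtration M X k)"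
  unfolding subalgebra_def sets_natural_filtration using assms
  by (auto intro!: sigma_sets_mono' intro: order_trans)

lemma X_adapted:
  assumes "1 \<le> i" "i \<le> n"
  shows "X i \<in> borel_measurable (natural_filtration M X n)"
proof (rule measurableI)
  fix B :: "real set" assume "B \<in> sets borel"
  with assms show "X i -` B \<inter> space (natural_filtration M X n) \<in> sets (natural_filtration M X n)"
    unfolding sets_natural_filtration by (auto intro!: sigma_sets.Basic)
qed simp

lemma partial_sum_adapted:
  assumes "k \<le> n"
  shows "partial_sum X k \<in> borel_measurable (natural_filtration M X n)"
  unfolding partial_sum_def[abs_def] using assms by (intro borel_measurable_sum X_adapted) auto

text \<open>
  Stop at the first positive time at which the process exceeds \<open>c\<close>. On \<open>A\<close> this time is finite and the
  stopped value is at least \<open>c\<close>, while its expectation is at most 1; Markov's inequality does the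
  rest.
\<close>

lemma Ville_bound:
  assumes E: "e_process \<P> (natural_filtration M X) E" and P: "P \<in> \<P>" and c: "0 < c"
    and A: "A \<in> sets P" "\<And>\<omega>. \<omega> \<in> A \<Longrightarrow> \<exists>n\<ge>1. c < E n \<omega>"
  shows "emeasure P A \<le> ennreal (1 / c)"
proof -
  define \<tau> where "\<tau> \<omega> = (if \<exists>n\<ge>1. c < E n \<omega> then enat (LEAST n. 1 \<le> n \<and> c < E n \<omega>) else \<infinity>)" for \<omega>
  have le_iff: "\<tau> \<omega> \<le> enat n \<longleftrightarrow> (\<exists>k\<in>{1..n}. c < E k \<omega>)" for \<omega> n
  proof (cases "\<exists>n\<ge>1. c < E n \<omega>")
    case True
    let ?L = "LEAST n. 1 \<le> n \<and> c < E n \<omega>"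
    have "1 \<le> ?L \<and> c < E ?L \<omega>"
      using True by (metis (mono_tags, lifting) LeastI)
    moreover have "?L \<le> k" if "1 \<le> k" "c < E k \<omega>" for k
      using that by (intro Least_le) simp
    ultimately have "?L \<le> n \<longleftrightarrow> (\<exists>k\<in>{1..n}. c < E k \<omega>)"
      by (meson atLeastAtMost_iff order_trans)
    then show ?thesis
      using True by (simp add: \<tau>_def)
  qed (auto simp: \<tau>_def)
  have "extended_stopping_time (natural_filtration M X) \<tau>"
    unfolding extended_stopping_time_def le_iff
  proof
    fix n
    have [measurable]: "E k \<in> borel_measurable (natural_filtration M X n)" if "k \<in> {1..n}" for k
    proof (rule measurable_from_subalg[OF subalgebra_natural_filtration])
      show "E k \<in> borel_measurable (natural_filtration M X k)"
        using E by (simp add: e_process_def)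
    qed (use that in simp)
    show "Measurable.pred (natural_filtration M X n) (\<lambda>\<omega>. \<exists>k\<in>{1..n}. c < E k \<omega>)"
      by measurable
  qed
  then have le_1: "(\<integral>\<^sup>+\<omega>. stopped_value E \<tau> \<omega> \<partial>P) \<le> 1"
    using E P by (simp add: e_process_def)
  have "ennreal c * emeasure P A = (\<integral>\<^sup>+\<omega>. ennreal c * indicator A \<omega> \<partial>P)"
    using A by (simp add: nn_integral_cmult_indicator)
  also have "\<dots> \<le> (\<integral>\<^sup>+\<omega>. stopped_value E \<tau> \<omega> \<partial>P)"
  proof (rule nn_integral_mono)
    fix \<omega>
    show "ennreal c * indicator A \<omega> \<le> stopped_value E \<tau> \<omega>"
    proof (cases "\<omega> \<in> A")
      case True
      then have ex: "\<exists>n. 1 \<le> n \<and> c < E n \<omega>"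
        using A by auto
      then have "c < E (LEAST n. 1 \<le> n \<and> c < E n \<omega>) \<omega>"
        by (metis (mono_tags, lifting) LeastI)
      then show ?thesis
        using ex True by (auto simp: stopped_value_def \<tau>_def intro!: ennreal_leI)
    qed simp
  qed
  also note le_1
  finally have "ennreal c * emeasure P A \<le> 1" .
  then have "ennreal (1 / c) * (ennreal c * emeasure P A) \<le> ennreal (1 / c) * 1"
    by (rule mult_left_mono) simp
  moreover have "ennreal (1 / c) * ennreal c = 1"
    using c by (simp add: ennreal_mult[symmetric])
  ultimately show ?thesis
    by (simp add: mult.assoc[symmetric])
qed

lemma uniform_SLLN_if_diverging_e_process:
  assumes E: "e_process \<P> (natural_filtration M X) E"
    and div: "diverges_tail_uniformly E (A_qdiv M X q)"
  shows "uniform_SLLN \<P> X q"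
  unfolding uniform_SLLN_iff
proof (intro allI impI)
  fix \<epsilon> \<delta> :: real assume \<epsilon>: "0 < \<epsilon>" and \<delta>: "0 < \<delta>"
  have "(\<lambda>m. INF \<omega>\<in>A_qdiv M X q m \<epsilon>. SUP n\<in>{1..}. ereal (E n \<omega>)) \<longlonglongrightarrow> \<infinity>"
    using div \<epsilon> by (simp add: diverges_tail_uniformly_def)
  then have "\<forall>\<^sub>F m in sequentially. ereal (1 / \<delta>) < (INF \<omega>\<in>A_qdiv M X q m \<epsilon>. SUP n\<in>{1..}. ereal (E n \<omega>))"
    by (simp add: tendsto_PInfty)
  then show "\<forall>\<^sub>F m in sequentially. \<forall>P\<in>\<P>. emeasure P (A_qdiv M X q m \<epsilon>) \<le> ennreal \<delta>"
  proof eventually_elim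
    case (elim m)
    have "\<exists>n\<ge>1. 1 / \<delta> < E n \<omega>" if "\<omega> \<in> A_qdiv M X q m \<epsilon>" for \<omega>
    proof -
      have "ereal (1 / \<delta>) < (SUP n\<in>{1..}. ereal (E n \<omega>))"
        using elim that by (rule less_INF_D)
      then show ?thesis
        by (auto simp: less_SUP_iff)
    qed
    then show ?case
      using Ville_bound[OF E _ _ A_qdiv_sets, of _ "1 / \<delta>"] \<delta> by simp
  qed
qed

text \<open>
  The \<open>e\<close>-process counts alarms. Alarm \<open>j\<close> goes off when the ratio reaches \<open>1 / (j + 1)\<close> at
  time \<open>m j\<close> or later, and \<open>m j\<close> is so large that this ever happens with probability at most
  \<open>(1 / 2) ^ (j + 1)\<close> under every \<open>P\<close>. The total number of alarms then has expectation at most 1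
  and dominates the process at all times, hence also its limsup. A single ratio of at least \<open>\<epsilon>\<close> at a
  late time \<open>k\<close> sets off every alarm \<open>j\<close> with \<open>1 / (j + 1) \<le> \<epsilon>\<close> and \<open>m j \<le> k\<close>, so that the count
  is large on the events of the lattice.
\<close>

lemma diverging_e_process_if_uniform_SLLN:
  assumes "uniform_SLLN \<P> X q"
  shows "\<exists>E. e_process \<P> (natural_filtration M X) E \<and> diverges_tail_uniformly E (A_qdiv M X q)"
proof -
  let ?r = "\<lambda>k \<omega>. \<bar>partial_sum X k \<omega>\<bar> / real k powr (1 / q)"
  let ?\<epsilon> = "\<lambda>j. 1 / real (Suc j)"
  have "\<exists>m. \<forall>P\<in>\<P>. emeasure P (A_qdiv M X q m (?\<epsilon> j)) \<le> ennreal ((1 / 2) ^ Suc j)" for j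
  proof -
    have "\<forall>\<^sub>F m in sequentially. \<forall>P\<in>\<P>. emeasure P (A_qdiv M X q m (?\<epsilon> j)) \<le> ennreal ((1 / 2) ^ Suc j)"
      by (rule assms[unfolded uniform_SLLN_iff, rule_format]) auto
    then show ?thesis
      by (auto simp: eventually_sequentially)
  qed
  then obtain m where m: "\<And>j P. P \<in> \<P> \<Longrightarrow> emeasure P (A_qdiv M X q (m j) (?\<epsilon> j)) \<le> ennreal ((1 / 2) ^ Suc j)"
    by metis
  \<comment> \<open>Only the first \<open>n\<close> alarms are counted up to time \<open>n\<close>, which keeps the count finite.\<close>
  define E where "E n \<omega> = (\<Sum>j<n. if \<exists>k\<in>{m j..n}. ?\<epsilon> j \<le> ?r k \<omega> then 1 else 0 :: real)" for n \<omega>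
  define T :: "'a \<Rightarrow> ennreal" where "T \<omega> = (\<Sum>j. indicator (A_qdiv M X q (m j) (?\<epsilon> j)) \<omega>)" for \<omega>
  have E_nonneg: "0 \<le> E n \<omega>" for n \<omega>
    unfolding E_def by (intro sum_nonneg) auto
  have E_le: "ennreal (E n \<omega>) \<le> T \<omega>" if "\<omega> \<in> space M" for n \<omega>
  proof -
    have "ennreal (E n \<omega>) = (\<Sum>j<n. ennreal (if \<exists>k\<in>{m j..n}. ?\<epsilon> j \<le> ?r k \<omega> then 1 else 0))"
      unfolding E_def by (intro sum_ennreal[symmetric]) auto
    also have "\<dots> \<le> (\<Sum>j<n. indicator (A_qdiv M X q (m j) (?\<epsilon> j)) \<omega>)"
      using that by (intro sum_mono) (auto simp: A_qdiv_iff indicator_def)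
    also have "\<dots> \<le> T \<omega>"
      unfolding T_def by (intro sum_le_suminf) auto
    finally show ?thesis .
  qed
  have "e_process \<P> (natural_filtration M X) E"
    unfolding e_process_def
  proof (intro conjI allI ballI impI)
    show "E n \<in> borel_measurable (natural_filtration M X n)" for n
    proof -
      have [measurable]: "partial_sum X k \<in> borel_measurable (natural_filtration M X n)"
        if "k \<in> {m j..n}" for j k
        using that by (intro partial_sum_adapted) simp
      show ?thesis
        unfolding E_def[abs_def] by measurable
    qed
    show "0 \<le> E n \<omega>" for n \<omega>
      by (rule E_nonneg)
    fix P \<tau> assume P: "P \<in> \<P>"
    have "(\<integral>\<^sup>+\<omega>. stopped_value E \<tau> \<omega> \<partial>P) \<le> (\<integral>\<^sup>+\<omega>. T \<omega> \<partial>P)"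
    proof (rule nn_integral_mono)
      fix \<omega> assume "\<omega> \<in> space P"
      then show "stopped_value E \<tau> \<omega> \<le> T \<omega>"
        using E_le[of \<omega>] space_eq[OF P]
        by (auto simp: stopped_value_def split: enat.split intro!: Limsup_bounded)
    qed
    also have "\<dots> = (\<Sum>j. emeasure P (A_qdiv M X q (m j) (?\<epsilon> j)))"
      unfolding T_def using A_qdiv_sets[OF P] by (subst nn_integral_suminf) auto
    also have "\<dots> \<le> (\<Sum>j. ennreal ((1 / 2) ^ Suc j))"
      using m[OF P] by (intro suminf_le) auto
    also have "\<dots> = ennreal 1"
      by (rule suminf_ennreal_eq[OF _ power_half_series]) simp
    finally show "(\<integral>\<^sup>+\<omega>. stopped_value E \<tau> \<omega> \<partial>P) \<le> 1"
      by simp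
  qed
  moreover have "diverges_tail_uniformly E (A_qdiv M X q)"
    unfolding diverges_tail_uniformly_def tendsto_PInfty
  proof (intro allI impI)
    fix \<epsilon> r :: real assume "0 < \<epsilon>"
    then obtain J where J: "?\<epsilon> J < \<epsilon>"
      using reals_Archimedean by (auto simp: inverse_eq_divide)
    obtain L :: nat where L: "max r 1 < real L"
      using reals_Archimedean2 by blast
    show "\<forall>\<^sub>F n in sequentially. ereal r < (INF \<omega>\<in>A_qdiv M X q n \<epsilon>. SUP n\<in>{1..}. ereal (E n \<omega>))"
      unfolding eventually_sequentially
    proof (intro exI[of _ "Max (m ` {J..<J + L})"] allI impI)
      fix N assume N: "Max (m ` {J..<J + L}) \<le> N"
      have *: "ereal (real L) \<le> (SUP n\<in>{1..}. ereal (E n \<omega>))" if \<omega>: "\<omega> \<in> A_qdiv M X q N \<epsilon>" for \<omega>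
      proof -
        obtain k where k: "N \<le> k" "\<epsilon> \<le> ?r k \<omega>"
          using \<omega> by (auto simp: A_qdiv_iff)
        \<comment> \<open>Time \<open>J + L\<close> is needed for the count to include alarms \<open>J, \<dots>, J + L - 1\<close>.\<close>
        let ?n = "max k (J + L)"
        have hit: "\<exists>k\<in>{m j..?n}. ?\<epsilon> j \<le> ?r k \<omega>" if j: "j \<in> {J..<J + L}" for j
        proof (rule bexI[of _ k])
          have "?\<epsilon> j \<le> ?\<epsilon> J"
            using j by (intro divide_left_mono) auto
          with J k show "?\<epsilon> j \<le> ?r k \<omega>"
            by linarith
          have "m j \<le> N"
            using N j by (auto intro: order_trans[OF Max_ge])
          with k show "k \<in> {m j..?n}"
            by simp
        qed
        have "real L = (\<Sum>j\<in>{J..<J + L}. if \<exists>k\<in>{m j..?n}. ?\<epsilon> j \<le> ?r k \<omega> then 1 else 0)"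
          using hit by simp
        also have "\<dots> \<le> E ?n \<omega>"
          unfolding E_def by (intro sum_mono2) auto
        finally show ?thesis
          using L by (intro SUP_upper2[of ?n]) auto
      qed
      have "ereal r < ereal (real L)"
        using L by simp
      also have "\<dots> \<le> (INF \<omega>\<in>A_qdiv M X q N \<epsilon>. SUP n\<in>{1..}. ereal (E n \<omega>))"
        using * by (intro INF_greatest)
      finally show "ereal r < (INF \<omega>\<in>A_qdiv M X q N \<epsilon>. SUP n\<in>{1..}. ereal (E n \<omega>))" .
    qed
  qed
  ultimately show ?thesis
    by blast
qed

end

section \<open>Sums of powers and a quantitative Kronecker lemma\<close>

text \<open>
  The comparison of the sum with the integral of \<open>t powr (s - 1)\<close>. The increment of \<open>t powr s / s\<close>
  is bounded below by concavity of \<open>t powr s\<close>, used in the form of the weighted arithmetic-geometric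
  mean inequality.
\<close>

lemma sum_powr_le:
  fixes s :: real
  assumes "0 < s" "s \<le> 1"
  shows "(\<Sum>i=1..n. real i powr (s - 1)) \<le> real n powr s / s"
proof (induction n)
  case (Suc n)
  have *: "real n powr s * (1 + real n) powr (1 - s) \<le> s * real n + (1 - s) * (1 + real n)"
    using Youngs_inequality_0[of s "1 - s" "real n" "1 + real n"] assms 
    by (cases "s = 1"; cases "n = 0") auto
  have "real n powr s = real n powr s * (1 + real n) powr (1 - s) * (1 + real n) powr (s - 1)"
    by (simp add: powr_add[symmetric])
  also have "\<dots> \<le> (s * real n + (1 - s) * (1 + real n)) * (1 + real n) powr (s - 1)"
    using * by (rule mult_right_mono) simp
  also have "\<dots> = (1 + real n) * (1 + real n) powr (s - 1) - s * (1 + real n) powr (s - 1)"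
    by (simp add: algebra_simps)
  also have "(1 + real n) * (1 + real n) powr (s - 1) = (1 + real n) powr s"
    by (simp add: powr_mult_base)
  finally have "(1 + real n) powr (s - 1) \<le> (1 + real n) powr s / s - real n powr s / s"
    using assms by (simp add: field_simps)
  then show ?case
    using Suc by (simp add: add.commute)
qed simp

text \<open>
  The step of the integral test for \<open>t powr (-a)\<close>: it follows from \<open>ln (1 - 1 / t) \<le> - 1 / t\<close> and
  \<open>exp x \<ge> 1 + x\<close>.
\<close>

lemma powr_diff_ge:
  fixes a t :: real
  assumes "1 < a" "1 < t"
  shows "(a - 1) * t powr (-a) \<le> (t - 1) powr (1 - a) - t powr (1 - a)"
proof -
  have "ln (1 - 1 / t) \<le> - (1 / t)"
    using ln_le_minus_one[of "1 - 1 / t"] assms by simp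
  then have "1 + (a - 1) / t \<le> 1 + (1 - a) * ln (1 - 1 / t)"
    using mult_left_mono[of "ln (1 - 1 / t)" "- (1 / t)" "a - 1"] assms by (simp add: algebra_simps)
  also have "\<dots> \<le> (1 - 1 / t) powr (1 - a)"
    using exp_ge_add_one_self[of "(1 - a) * ln (1 - 1 / t)"] assms by (simp add: powr_def)
  finally have "t powr (1 - a) * (1 + (a - 1) / t) \<le> t powr (1 - a) * (1 - 1 / t) powr (1 - a)"
    by (rule mult_left_mono) simp
  also have "\<dots> = (t * (1 - 1 / t)) powr (1 - a)"
    by (simp add: powr_mult)
  also have "t * (1 - 1 / t) = t - 1"
    using assms by (simp add: field_simps)
  finally have "t powr (1 - a) * (1 + (a - 1) / t) \<le> (t - 1) powr (1 - a)" .
  moreover have "t powr (1 - a) = t * t powr (- a)"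
    using assms by (simp add: powr_mult_base)
  then have "t powr (1 - a) * (1 + (a - 1) / t) = t powr (1 - a) + (a - 1) * t powr (- a)"
    using assms by (simp add: field_simps)
  ultimately show ?thesis
    by simp
qed

text \<open>
  The integral test gives \<open>w powr (1 - a) / (a - 1)\<close> for the terms whose predecessor is at least
  \<open>w\<close>. The first term after \<open>w\<close> is bounded by \<open>w powr (-a) \<le> w powr (1 - a)\<close>; adding the two
  constants gives \<open>a / (a - 1)\<close>.
\<close>

lemma sum_powr_tail_le:
  fixes a w :: real
  assumes a: "1 < a" and w: "1 \<le> w"
  shows "(\<Sum>i | i \<in> {1..n} \<and> w < real i. real i powr (-a)) \<le> a / (a - 1) * w powr (1 - a)"
proof -
  have id: "a / (a - 1) * c - c / (a - 1) = c" for c :: real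
  proof -
    have "a / (a - 1) * c - c / (a - 1) = (a - 1) * c / (a - 1)"
      by (simp only: left_diff_distrib diff_divide_distrib mult_1 times_divide_eq_left)
    then show ?thesis
      using a by simp
  qed
  have "(\<Sum>i | i \<in> {1..n} \<and> w < real i. real i powr (-a))
      \<comment> \<open>For the induction on \<open>n\<close>, subtract what the terms after \<open>n\<close> may still contribute.\<close>
      \<le> a / (a - 1) * w powr (1 - a) - max w (real n) powr (1 - a) / (a - 1)"
  proof (induction n)
    case 0
    show ?case
      using w id[of "w powr (1 - a)"] by (simp add: max_def)
  next
    case (Suc n)
    let ?S = "\<lambda>n. \<Sum>i | i \<in> {1..n} \<and> w < real i. real i powr (-a)"
    consider "real (Suc n) \<le> w" | "real n < w" "w < real (Suc n)" | "w \<le> real n"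
      by linarith
    then show ?case
    proof cases
      case 1
      have "{i \<in> {1..Suc n}. w < real i} = {i \<in> {1..n}. w < real i}"
        using 1 by (auto simp: le_Suc_eq)
      then show ?thesis
        using Suc 1 by (simp add: max_def)
    next
      case 2
      have "{i \<in> {1..Suc n}. w < real i} = {Suc n}"
        using 2 by (auto simp: le_Suc_eq)
      then have "?S (Suc n) = real (Suc n) powr (-a)"
        by simp
      also have "\<dots> \<le> w powr (-a)"
        using 2 a w by (intro powr_mono2') auto
      also have "\<dots> \<le> w powr (1 - a)"
        using w by (intro powr_mono) auto
      also have "\<dots> = a / (a - 1) * w powr (1 - a) - w powr (1 - a) / (a - 1)"
        by (rule id[symmetric])
      also have "\<dots> \<le> a / (a - 1) * w powr (1 - a) - real (Suc n) powr (1 - a) / (a - 1)"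
        using powr_mono2'[of "1 - a" w "real (Suc n)"] a w 2 by (simp add: divide_right_mono)
      finally show ?thesis
        using 2 by (simp add: max_def)
    next
      case 3
      have "{i \<in> {1..Suc n}. w < real i} = insert (Suc n) {i \<in> {1..n}. w < real i}"
        using 3 by (auto simp: le_Suc_eq)
      then have "?S (Suc n) = real (Suc n) powr (-a) + ?S n"
        by simp
      also have "real (Suc n) powr (-a) \<le> (real n powr (1 - a) - real (Suc n) powr (1 - a)) / (a - 1)"
        using powr_diff_ge[of a "real (Suc n)"] a w 3 by (simp add: field_simps)
      finally show ?thesis
        using Suc 3 by (simp add: max_def diff_divide_distrib)
    qed
  qed
  also have "\<dots> \<le> a / (a - 1) * w powr (1 - a)"
    using a by simp
  finally show ?thesis .
qed

text \<open>
  With \<open>a = 2 / q\<close> and \<open>z = \<bar>x\<bar> powr q\<close>, the left-hand side is the sum of the squares of the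
  truncations of \<open>x\<close>, each divided by its normalization \<open>i powr (2 / q)\<close>. Summing over \<open>i\<close> before
  taking expectations leaves one factor \<open>z\<close>, i.e. exactly a \<open>q\<close>-th moment. If \<open>z < K\<close>, there is the
  additional factor \<open>(K / m) powr (a - 1)\<close>, because the sum only starts after \<open>m\<close>. Hence the
  expectation of the right-hand side is small for large \<open>K\<close> and much larger \<open>m\<close>, uniformly over a
  uniformly integrable family.
\<close>

lemma truncated_square_sum_le:
  fixes a z K :: real
  assumes a: "1 < a" and z: "0 \<le> z" and K: "0 < K" "K \<le> real m" and m: "1 \<le> m"
  shows "(\<Sum>i\<in>{m<..n}. (if z < real i then z powr a else 0) * real i powr (-a))
     \<le> a / (a - 1) * ((if K \<le> z then z else 0) + (K / real m) powr (a - 1) * z)"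
proof -
  let ?w = "max (real m) z"
  have "(\<Sum>i\<in>{m<..n}. (if z < real i then z powr a else 0) * real i powr (-a))
      = (\<Sum>i | i \<in> {1..n} \<and> ?w < real i. z powr a * real i powr (-a))"
    by (rule sum.mono_neutral_cong_right) auto
  also have "\<dots> = z powr a * (\<Sum>i | i \<in> {1..n} \<and> ?w < real i. real i powr (-a))"
    by (simp add: sum_distrib_left)
  also have "\<dots> \<le> z powr a * (a / (a - 1) * ?w powr (1 - a))"
    using a m by (intro mult_left_mono sum_powr_tail_le) auto
  also have "\<dots> = a / (a - 1) * (z powr a * ?w powr (1 - a))"
    by simp
  also have "\<dots> \<le> a / (a - 1) * ((if K \<le> z then z else 0) + (K / real m) powr (a - 1) * z)"
  proof (rule mult_left_mono)
    have split: "z powr a = z * z powr (a - 1)"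
      using z by (simp add: powr_mult_base)
    show "z powr a * ?w powr (1 - a) \<le> (if K \<le> z then z else 0) + (K / real m) powr (a - 1) * z"
    proof (cases "z < K")
      case True
      have "z powr a * real m powr (1 - a) = (z / real m) powr (a - 1) * z"
        using powr_minus_divide[of "real m" "a - 1"] by (simp add: split powr_divide)
      also have "\<dots> \<le> (K / real m) powr (a - 1) * z"
        using z a True by (intro mult_right_mono powr_mono2 divide_right_mono) auto
      finally show ?thesis
        using True K by (simp add: max_def)
    next
      case False
      have "z powr a * ?w powr (1 - a) \<le> z powr a * z powr (1 - a)"
        using a False K by (intro mult_left_mono powr_mono2') auto
      also have "\<dots> = z"
        using z by (simp add: powr_add[symmetric])
      finally show ?thesis
        using False z by (simp add: add_increasing2)
    qed
  qed (use a in simp)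
  finally show ?thesis .
qed

text \<open>
  A quantitative form of Kronecker's lemma, by summation by parts. In terms of the normalized sums
  \<open>U\<close>, the sums \<open>T\<close> satisfy \<open>T k = b k * U k - (\<Sum>i<k. (b (i + 1) - b i) * U i)\<close>, and the
  increments of \<open>b\<close> add up to at most \<open>b k\<close>. The induction bounds the difference
  \<open>T k - b k * U k\<close>.
\<close>

lemma Kronecker_bound:
  fixes b y :: "nat \<Rightarrow> real"
  assumes b: "\<And>i. 1 \<le> i \<Longrightarrow> 0 < b i" "mono b" "0 \<le> b 0"
    and U: "\<And>k. k \<le> n \<Longrightarrow> \<bar>\<Sum>i\<in>{m<..k}. y i / b i\<bar> \<le> \<delta>"
  shows "\<bar>\<Sum>i\<in>{m<..n}. y i\<bar> \<le> 2 * \<delta> * b n"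
proof -
  define U where "U k = (\<Sum>i\<in>{m<..k}. y i / b i)" for k
  define T where "T k = (\<Sum>i\<in>{m<..k}. y i)" for k
  have U_le: "\<bar>U k\<bar> \<le> \<delta>" if "k \<le> n" for k
    using U[OF that] by (simp add: U_def)
  have b0: "0 \<le> b k" for k
    using b(1)[of k] b(3) by (cases "k = 0") auto
  have \<delta>: "0 \<le> \<delta>"
    using U_le[of n] by simp
  have "\<bar>T k - b k * U k\<bar> \<le> \<delta> * b k" if "k \<le> n" for k
    using that
  proof (induction k)
    case 0
    then show ?case
      using \<delta> b0 by (simp add: T_def U_def)
  next
    case (Suc k)
    show ?case
    proof (cases "m < Suc k")
      case True
      then have "{m<..Suc k} = insert (Suc k) {m<..k}"
        by auto
      then have "T (Suc k) - b (Suc k) * U (Suc k) = (T k - b k * U k) - (b (Suc k) - b k) * U k"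
        using b(1)[of "Suc k"] by (simp add: T_def U_def algebra_simps)
      also have "\<bar>\<dots>\<bar> \<le> \<bar>T k - b k * U k\<bar> + (b (Suc k) - b k) * \<bar>U k\<bar>"
        using monoD[OF b(2), of k "Suc k"]
        by (intro order_trans[OF abs_triangle_ineq4]) (simp add: abs_mult)
      also have "\<dots> \<le> \<delta> * b k + (b (Suc k) - b k) * \<delta>"
        using Suc U_le[of k] monoD[OF b(2), of k "Suc k"] by (intro add_mono mult_left_mono) auto
      finally show ?thesis
        by (simp add: algebra_simps)
    next
      case False
      then show ?thesis
        using \<delta> b0 by (simp add: T_def U_def)
    qed
  qed
  from this[of n] have "\<bar>T n\<bar> \<le> \<delta> * b n + b n * \<bar>U n\<bar>"
    using abs_triangle_ineq[of "T n - b n * U n" "b n * U n"] b0[of n] by (simp add: abs_mult)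
  also have "b n * \<bar>U n\<bar> \<le> b n * \<delta>"
    using U_le[of n] b0 by (intro mult_left_mono) auto
  finally show ?thesis
    by (simp add: T_def algebra_simps)
qed

section \<open>Kolmogorov's maximal inequality\<close>

text \<open>
  The partial sums \<open>z 1 + \<dots> + z n\<close>, frozen as soon as they leave the interval \<open>(-\<delta>, \<delta>)\<close>. Freezing
  the sums replaces the decomposition over the first exit time in the usual proof of Kolmogorov's
  inequality.
\<close>

primrec stopped_sum :: "real \<Rightarrow> (nat \<Rightarrow> real) \<Rightarrow> nat \<Rightarrow> real" where
  "stopped_sum \<delta> z 0 = 0"
| "stopped_sum \<delta> z (Suc n) =
     stopped_sum \<delta> z n + (if \<bar>stopped_sum \<delta> z n\<bar> < \<delta> then z (Suc n) else 0)"

lemma stopped_sum_cong: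
  assumes "\<And>i. i \<in> {1..n} \<Longrightarrow> z i = z' i"
  shows "stopped_sum \<delta> z n = stopped_sum \<delta> z' n"
  using assms by (induction n) auto

lemma stopped_sum_ge:
  assumes "k \<le> n" "\<delta> \<le> \<bar>\<Sum>i=1..k. z i\<bar>"
  shows "\<delta> \<le> \<bar>stopped_sum \<delta> z n\<bar>"
proof -
  have "\<delta> \<le> \<bar>stopped_sum \<delta> z n\<bar> \<or>
      stopped_sum \<delta> z n = (\<Sum>i=1..n. z i) \<and> (\<forall>k\<le>n. \<bar>\<Sum>i=1..k. z i\<bar> < \<delta>)"
  proof (induction n)
    case (Suc n)
    then show ?case
    proof (elim disjE conjE)
      assume *: "stopped_sum \<delta> z n = (\<Sum>i=1..n. z i)" "\<forall>k\<le>n. \<bar>\<Sum>i=1..k. z i\<bar> < \<delta>"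
      then have "stopped_sum \<delta> z (Suc n) = (\<Sum>i=1..Suc n. z i)"
        by simp
      with *(2) show ?thesis
        by (metis le_SucE not_le)
    qed simp
  qed auto
  then show ?thesis
    using assms by force
qed

lemma measurable_stopped_sum:
  "k \<le> n \<Longrightarrow> (\<lambda>z. stopped_sum \<delta> z k) \<in> borel_measurable (PiM {1..n} (\<lambda>_. borel))"
proof (induction k)
  case (Suc k)
  have [measurable]: "(\<lambda>z. stopped_sum \<delta> z k) \<in> borel_measurable (PiM {1..n} (\<lambda>_. borel))"
    using Suc by simp
  have [measurable]: "(\<lambda>z. z (Suc k)) \<in> borel_measurable (PiM {1..n} (\<lambda>_. borel))"
    using Suc.prems by (intro measurable_component_singleton) auto
  show ?case
    by (simp only: stopped_sum.simps) measurable
qed simp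

text \<open>
  The increment number \<open>k + 1\<close> is \<open>Z (k + 1)\<close> or \<open>0\<close>, as decided by \<open>Z 1, \<dots>, Z k\<close>. It is therefore
  orthogonal to the stopped sum before it, so that second moments add up, and freezing can only
  make them smaller.
\<close>

lemma (in prob_space) stopped_sum_second_moment:
  fixes \<delta> :: real
  assumes ind: "indep_vars (\<lambda>_. borel) Z {1..n::nat}"
    and sq: "\<And>i. i \<in> {1..n} \<Longrightarrow> integrable M (\<lambda>\<omega>. (Z i \<omega>)\<^sup>2)"
    and mean: "\<And>i. i \<in> {1..n} \<Longrightarrow> expectation (Z i) = 0"
    and k: "k \<le> n"
  defines "W \<equiv> \<lambda>k \<omega>. stopped_sum \<delta> (\<lambda>i. Z i \<omega>) k"
  shows "integrable M (\<lambda>\<omega>. (W k \<omega>)\<^sup>2)"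
    and "expectation (\<lambda>\<omega>. (W k \<omega>)\<^sup>2) \<le> (\<Sum>i=1..k. expectation (\<lambda>\<omega>. (Z i \<omega>)\<^sup>2))"
proof -
  have Z[measurable]: "random_variable borel (Z i)" if "i \<in> {1..n}" for i
    using ind that by (auto simp: indep_vars_def)
  have W[measurable]: "random_variable borel (W k)" if "k \<le> n" for k
    using that
  proof (induction k)
    case (Suc k)
    then show ?case
      using Z[of "Suc k"] by (simp add: W_def)
  qed (simp add: W_def)
  have "integrable M (\<lambda>\<omega>. (W k \<omega>)\<^sup>2) \<and>
      expectation (\<lambda>\<omega>. (W k \<omega>)\<^sup>2) \<le> (\<Sum>i=1..k. expectation (\<lambda>\<omega>. (Z i \<omega>)\<^sup>2))"
    using k
  proof (induction k)
    case 0
    then show ?case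
      by (simp add: W_def)
  next
    case (Suc k)
    \<comment> \<open>The product of the stopped sum with its next increment is \<open>g (W k) * Z (Suc k)\<close>.\<close>
    define g :: "real \<Rightarrow> real" where "g w = (if \<bar>w\<bar> < \<delta> then w else 0)" for w
    define D where "D \<omega> = (if \<bar>W k \<omega>\<bar> < \<delta> then Z (Suc k) \<omega> else 0)" for \<omega>
    have k: "k \<le> n" "Suc k \<in> {1..n}"
      using Suc.prems by auto
    note [measurable] = W[OF k(1)] Z[OF k(2)]
    have [measurable]: "random_variable borel D"
      unfolding D_def by simp
    have [measurable]: "g \<in> borel_measurable borel"
      unfolding g_def by simp
    have IH: "integrable M (\<lambda>\<omega>. (W k \<omega>)\<^sup>2)"
      "expectation (\<lambda>\<omega>. (W k \<omega>)\<^sup>2) \<le> (\<Sum>i=1..k. expectation (\<lambda>\<omega>. (Z i \<omega>)\<^sup>2))"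
      using Suc.IH[OF k(1)] by auto
    have "indep_var borel
        ((\<lambda>z. g (stopped_sum \<delta> z k)) \<circ> (\<lambda>\<omega>. restrict (\<lambda>i. Z i \<omega>) {1..k})) borel
        ((\<lambda>z. z (Suc k)) \<circ> (\<lambda>\<omega>. restrict (\<lambda>i. Z i \<omega>) {Suc k}))"
    proof (rule indep_var_compose)
      show "indep_var (PiM {1..k} (\<lambda>_. borel)) (\<lambda>\<omega>. restrict (\<lambda>i. Z i \<omega>) {1..k})
         (PiM {Suc k} (\<lambda>_. borel)) (\<lambda>\<omega>. restrict (\<lambda>i. Z i \<omega>) {Suc k})"
        using k by (intro indep_var_restrict[OF ind]) auto
      show "(\<lambda>z. g (stopped_sum \<delta> z k)) \<in> borel_measurable (PiM {1..k} (\<lambda>_. borel))"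
        using measurable_stopped_sum[of k k \<delta>] by measurable
    qed (rule measurable_component_singleton, simp)
    moreover have "(\<lambda>z. g (stopped_sum \<delta> z k)) \<circ> (\<lambda>\<omega>. restrict (\<lambda>i. Z i \<omega>) {1..k}) = (\<lambda>\<omega>. g (W k \<omega>))"
      unfolding W_def comp_def by (intro ext arg_cong[where f = g] stopped_sum_cong) simp
    moreover have "(\<lambda>z. z (Suc k)) \<circ> (\<lambda>\<omega>. restrict (\<lambda>i. Z i \<omega>) {Suc k}) = Z (Suc k)"
      by auto
    ultimately have indep: "indep_var borel (\<lambda>\<omega>. g (W k \<omega>)) borel (Z (Suc k))"
      by simp
    have int_Z: "integrable M (Z (Suc k))"
      using square_integrable_imp_integrable[OF _ sq[OF k(2)]] by simp
    have int_g: "integrable M (\<lambda>\<omega>. g (W k \<omega>))"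
      by (rule integrable_const_bound[where B = "\<bar>\<delta>\<bar>"]) (auto simp: g_def)
    have cross: "integrable M (\<lambda>\<omega>. g (W k \<omega>) * Z (Suc k) \<omega>)"
        "expectation (\<lambda>\<omega>. g (W k \<omega>) * Z (Suc k) \<omega>) = 0"
      using indep_var_integrable[OF indep int_g int_Z] 
        indep_var_lebesgue_integral[OF indep int_g int_Z] mean[OF k(2)]
      by (auto simp: mult.commute)
    have int_D: "integrable M (\<lambda>\<omega>. (D \<omega>)\<^sup>2)"
      by (rule Bochner_Integration.integrable_bound[OF sq[OF k(2)]]) (auto simp: D_def)
    have D_le: "expectation (\<lambda>\<omega>. (D \<omega>)\<^sup>2) \<le> expectation (\<lambda>\<omega>. (Z (Suc k) \<omega>)\<^sup>2)"
      by (rule integral_mono[OF int_D sq[OF k(2)]]) (simp add: D_def)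
    have eq: "(W (Suc k) \<omega>)\<^sup>2 = (W k \<omega>)\<^sup>2 + (D \<omega>)\<^sup>2 + 2 * (g (W k \<omega>) * Z (Suc k) \<omega>)" for \<omega>
      by (simp add: W_def D_def g_def power2_sum)
    show ?case
      using IH int_D cross D_le by (simp add: eq)
  qed
  then show "integrable M (\<lambda>\<omega>. (W k \<omega>)\<^sup>2)"
    and "expectation (\<lambda>\<omega>. (W k \<omega>)\<^sup>2) \<le> (\<Sum>i=1..k. expectation (\<lambda>\<omega>. (Z i \<omega>)\<^sup>2))"
    by auto
qed

text \<open>
  If some partial sum leaves \<open>(-\<delta>, \<delta>)\<close>, then the stopped sum is still outside at time \<open>n\<close>. Hence
  Chebyshev's inequality for this one random variable controls the whole maximum.
\<close>

lemma (in prob_space) Kolmogorov_maximal_inequality: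
  assumes ind: "indep_vars (\<lambda>_. borel) Z {1..n::nat}"
    and sq: "\<And>i. i \<in> {1..n} \<Longrightarrow> integrable M (\<lambda>\<omega>. (Z i \<omega>)\<^sup>2)"
    and mean: "\<And>i. i \<in> {1..n} \<Longrightarrow> expectation (Z i) = 0"
    and \<delta>: "0 < \<delta>"
  shows "prob {\<omega> \<in> space M. \<exists>k\<le>n. \<delta> \<le> \<bar>\<Sum>i=1..k. Z i \<omega>\<bar>}
    \<le> (\<Sum>i=1..n. expectation (\<lambda>\<omega>. (Z i \<omega>)\<^sup>2)) / \<delta>\<^sup>2"
proof -
  let ?W = "\<lambda>\<omega>. stopped_sum \<delta> (\<lambda>i. Z i \<omega>) n"
  note W = stopped_sum_second_moment[OF ind sq mean order_refl, of \<delta>]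
  have [measurable]: "(\<lambda>\<omega>. (?W \<omega>)\<^sup>2) \<in> borel_measurable M"
    using W(1) by auto
  have "prob {\<omega> \<in> space M. \<exists>k\<le>n. \<delta> \<le> \<bar>\<Sum>i=1..k. Z i \<omega>\<bar>} \<le> prob {\<omega> \<in> space M. \<delta>\<^sup>2 \<le> (?W \<omega>)\<^sup>2}"
  proof (rule finite_measure_mono)
    show "{\<omega> \<in> space M. \<exists>k\<le>n. \<delta> \<le> \<bar>\<Sum>i=1..k. Z i \<omega>\<bar>} \<subseteq> {\<omega> \<in> space M. \<delta>\<^sup>2 \<le> (?W \<omega>)\<^sup>2}"
    proof safe
      fix \<omega> k assume "k \<le> n" "\<delta> \<le> \<bar>\<Sum>i=1..k. Z i \<omega>\<bar>"
      then have "\<bar>\<delta>\<bar> \<le> \<bar>?W \<omega>\<bar>"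
        using stopped_sum_ge[of k n \<delta> "\<lambda>i. Z i \<omega>"] \<delta> by simp
      then show "\<delta>\<^sup>2 \<le> (?W \<omega>)\<^sup>2"
        by (simp only: abs_le_square_iff)
    qed
  qed simp
  also have "\<dots> \<le> expectation (\<lambda>\<omega>. (?W \<omega>)\<^sup>2) / \<delta>\<^sup>2"
    using \<delta> W(1) by (intro integral_Markov_inequality_measure[where A = "{}"]) auto
  also have "\<dots> \<le> (\<Sum>i=1..n. expectation (\<lambda>\<omega>. (Z i \<omega>)\<^sup>2)) / \<delta>\<^sup>2"
    using W(2) by (intro divide_right_mono) auto
  finally show ?thesis .
qed

section \<open>A deviation bound from truncated moments\<close>

(* Keeps the index of the variable X 1 in the form in which all lemmas state it. *)
declare One_nat_def [simp del]

locale iid_process = prob_space +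
  fixes X :: "nat \<Rightarrow> 'a \<Rightarrow> real"
  assumes iid: "iid_sequence M X"
begin

lemma indep: "indep_vars (\<lambda>_. borel) X {1..}"
  using iid unfolding iid_sequence_def by blast

lemma rv: "1 \<le> i \<Longrightarrow> random_variable borel (X i)"
  using indep by (auto simp: indep_vars_def)

lemma rv_1 [measurable]: "random_variable borel (X 1)"
  by (rule rv) simp

lemma partial_sum_rv [measurable]: "random_variable borel (partial_sum X k)"
  unfolding partial_sum_def[abs_def] using rv by (intro borel_measurable_sum) auto

lemma
  fixes f :: "real \<Rightarrow> real"
  assumes [measurable]: "f \<in> borel_measurable borel" and i: "1 \<le> i"
  shows expectation_identical: "expectation (\<lambda>\<omega>. f (X i \<omega>)) = expectation (\<lambda>\<omega>. f (X 1 \<omega>))"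
    and integrable_identical: "integrable M (\<lambda>\<omega>. f (X i \<omega>)) \<longleftrightarrow> integrable M (\<lambda>\<omega>. f (X 1 \<omega>))"
proof -
  note [measurable] = rv[OF i]
  have d: "distr M borel (X i) = distr M borel (X 1)"
    using iid i unfolding iid_sequence_def by metis
  show "expectation (\<lambda>\<omega>. f (X i \<omega>)) = expectation (\<lambda>\<omega>. f (X 1 \<omega>))"
    using integral_distr[OF rv[OF i] assms(1)] integral_distr[OF rv_1 assms(1)] d by metis
  show "integrable M (\<lambda>\<omega>. f (X i \<omega>)) \<longleftrightarrow> integrable M (\<lambda>\<omega>. f (X 1 \<omega>))"
    using integrable_distr_eq[OF rv[OF i] assms(1)] integrable_distr_eq[OF rv_1 assms(1)] d by metis
qed

lemma prob_identical:
  assumes [measurable]: "B \<in> sets borel" and i: "1 \<le> i"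
  shows "prob {\<omega> \<in> space M. X i \<omega> \<in> B} = prob {\<omega> \<in> space M. X 1 \<omega> \<in> B}"
proof -
  note [measurable] = rv[OF i]
  have "measure (distr M borel (X i)) B = measure (distr M borel (X 1)) B"
    using iid i unfolding iid_sequence_def by metis
  then show ?thesis
    using measure_distr[OF rv[OF i] assms(1)] measure_distr[OF rv_1 assms(1)]
    by (simp add: vimage_def Int_def conj_commute)
qed

end

text \<open>
  \<open>X i\<close> is truncated at the level of its normalization, \<open>\<bar>X i\<bar> < i powr (1 / q)\<close>. The condition is
  written with the \<open>q\<close>-th power because that is the variable whose tails are controlled.
\<close>

definition truncate_power :: "real \<Rightarrow> nat \<Rightarrow> real \<Rightarrow> real" where
  "truncate_power q i x = (if \<bar>x\<bar> powr q < real i then x else 0)"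

lemma measurable_truncate_power [measurable]: "truncate_power q i \<in> borel_measurable borel"
  unfolding truncate_power_def[abs_def] by measurable

lemma truncate_power_square:
  assumes "0 < q"
  shows "(truncate_power q i x)\<^sup>2 = (if \<bar>x\<bar> powr q < real i then (\<bar>x\<bar> powr q) powr (2 / q) else 0)"
  using assms by (simp add: truncate_power_def powr_powr)

lemma truncate_power_error:
  assumes q: "1 \<le> q" and i: "m \<le> i" "1 \<le> i"
  shows "\<bar>truncate_power q i x - x\<bar>
    \<le> real i powr (1 / q - 1) * (if real m \<le> \<bar>x\<bar> powr q then \<bar>x\<bar> powr q else 0)"
proof (cases "\<bar>x\<bar> powr q < real i")
  case False
  let ?z = "\<bar>x\<bar> powr q"
  have "\<bar>x\<bar> = ?z powr (1 / q - 1) * ?z"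
    using q by (simp add: powr_powr powr_add[symmetric] algebra_simps)
  also have "\<dots> \<le> real i powr (1 / q - 1) * ?z"
    using False q i by (intro mult_right_mono powr_mono2') auto
  finally show ?thesis
    using False i by (auto simp: truncate_power_def)
qed (simp add: truncate_power_def)

text \<open>
  Summed over identically distributed variables, this says that the probabilities of
  \<open>\<bar>X i\<bar> powr q \<ge> i\<close> for \<open>i > m\<close> add up to at most a tail of the \<open>q\<close>-th moment.
\<close>

lemma count_le_tail:
  assumes "0 \<le> z"
  shows "(\<Sum>i\<in>{m<..n}. if real i \<le> z then 1 else 0) \<le> (if real m \<le> z then z else 0)"
proof (cases "real m \<le> z")
  case True
  have "(\<Sum>i\<in>{m<..n}. if real i \<le> z then 1 else (0::real)) = real (card {i \<in> {m<..n}. real i \<le> z})"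
    by (simp add: sum.If_cases Int_def)
  also have "card {i \<in> {m<..n}. real i \<le> z} \<le> card {1..nat \<lfloor>z\<rfloor>}"
    by (intro card_mono) (auto simp: le_nat_floor)
  also have "real (card {1..nat \<lfloor>z\<rfloor>}) \<le> z"
    using assms by simp
  finally show ?thesis
    using True by simp
qed (auto intro!: sum_nonpos)

locale iid_centered_moment = iid_process +
  fixes q :: real
  assumes q: "1 \<le> q" "q < 2"
    and integrable_moment: "integrable M (\<lambda>\<omega>. \<bar>X 1 \<omega>\<bar> powr q)"
    and centered: "expectation (X 1) = 0"
begin

definition moment :: real where
  "moment = expectation (\<lambda>\<omega>. \<bar>X 1 \<omega>\<bar> powr q)"

definition tail_moment :: "real \<Rightarrow> real" where
  "tail_moment x = expectation (\<lambda>\<omega>. if x \<le> \<bar>X 1 \<omega>\<bar> powr q then \<bar>X 1 \<omega>\<bar> powr q else 0)"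

lemma tail_moment_nonneg: "0 \<le> tail_moment x"
  unfolding tail_moment_def by (intro integral_nonneg_AE) auto

lemma integrable_tail: "integrable M (\<lambda>\<omega>. if x \<le> \<bar>X 1 \<omega>\<bar> powr q then \<bar>X 1 \<omega>\<bar> powr q else 0)"
  by (rule Bochner_Integration.integrable_bound[OF integrable_moment]) auto

lemma abs_le_one_plus_powr: "\<bar>x\<bar> \<le> 1 + \<bar>x\<bar> powr q" for x :: real
proof (cases "\<bar>x\<bar> \<le> 1")
  case False
  then have "\<bar>x\<bar> powr 1 \<le> \<bar>x\<bar> powr q"
    using q by (intro powr_mono) auto
  then show ?thesis
    using False by simp
qed (simp add: add_increasing2)

lemma integrable_1: "integrable M (X 1)"
proof (rule Bochner_Integration.integrable_bound)
  show "integrable M (\<lambda>\<omega>. 1 + \<bar>X 1 \<omega>\<bar> powr q)"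
    using integrable_moment by simp
  show "AE \<omega> in M. norm (X 1 \<omega>) \<le> norm (1 + \<bar>X 1 \<omega>\<bar> powr q)"
    using abs_le_one_plus_powr by (auto intro!: AE_I2 order_trans[OF _ abs_ge_self])
qed measurable

lemma expectation_abs_partial_sum_le:
  "integrable M (partial_sum X k) \<and> expectation (\<lambda>\<omega>. \<bar>partial_sum X k \<omega>\<bar>) \<le> real k * (1 + moment)"
proof (induction k)
  case 0
  then show ?case
    by (simp add: partial_sum_def)
next
  case (Suc k)
  have int_X: "integrable M (X (Suc k))"
    using integrable_identical[of "\<lambda>x. x" "Suc k"] integrable_1 by simp
  have "expectation (\<lambda>\<omega>. \<bar>X (Suc k) \<omega>\<bar>) = expectation (\<lambda>\<omega>. \<bar>X 1 \<omega>\<bar>)"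
    by (rule expectation_identical) auto
  also have "\<dots> \<le> expectation (\<lambda>\<omega>. 1 + \<bar>X 1 \<omega>\<bar> powr q)"
    using integrable_1 integrable_moment abs_le_one_plus_powr by (intro integral_mono) auto
  also have "\<dots> = 1 + moment"
    using integrable_moment by (simp add: moment_def prob_space)
  finally have X: "expectation (\<lambda>\<omega>. \<bar>X (Suc k) \<omega>\<bar>) \<le> 1 + moment" .
  have S: "partial_sum X (Suc k) = (\<lambda>\<omega>. partial_sum X k \<omega> + X (Suc k) \<omega>)"
    by (auto simp: partial_sum_def)
  have int: "integrable M (partial_sum X (Suc k))"
    using Suc int_X by (simp add: S)
  have "expectation (\<lambda>\<omega>. \<bar>partial_sum X (Suc k) \<omega>\<bar>)
      \<le> expectation (\<lambda>\<omega>. \<bar>partial_sum X k \<omega>\<bar> + \<bar>X (Suc k) \<omega>\<bar>)"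
    using Suc int_X int by (intro integral_mono) (auto simp: S)
  also have "\<dots> \<le> real (Suc k) * (1 + moment)"
    using Suc int_X X by (simp add: algebra_simps)
  finally show ?case
    using int by simp
qed

lemma prob_exceeds_truncation_le:
  "prob {\<omega> \<in> space M. \<exists>i\<in>{m<..n}. real i \<le> \<bar>X i \<omega>\<bar> powr q} \<le> tail_moment m"
proof -
  let ?f = "\<lambda>i x. if real i \<le> \<bar>x\<bar> powr q then 1 else (0::real)"
  have m: "{\<omega> \<in> space M. real i \<le> \<bar>X i \<omega>\<bar> powr q} \<in> events" if "i \<in> {m<..n}" for i
  proof -
    have [measurable]: "random_variable borel (X i)"
      using that by (intro rv) auto
    show ?thesis
      by measurable
  qed
  have int: "integrable M (\<lambda>\<omega>. ?f i (X 1 \<omega>))" for i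
    by (rule integrable_const_bound[where B = 1]) auto
  have "{\<omega> \<in> space M. \<exists>i\<in>{m<..n}. real i \<le> \<bar>X i \<omega>\<bar> powr q}
      = (\<Union>i\<in>{m<..n}. {\<omega> \<in> space M. real i \<le> \<bar>X i \<omega>\<bar> powr q})"
    by auto
  then have "prob {\<omega> \<in> space M. \<exists>i\<in>{m<..n}. real i \<le> \<bar>X i \<omega>\<bar> powr q}
      \<le> (\<Sum>i\<in>{m<..n}. prob {\<omega> \<in> space M. real i \<le> \<bar>X i \<omega>\<bar> powr q})"
    using m by (auto intro!: finite_measure_subadditive_finite)
  also have "\<dots> = (\<Sum>i\<in>{m<..n}. expectation (\<lambda>\<omega>. ?f i (X 1 \<omega>)))"
  proof (rule sum.cong[OF refl])
    fix i assume i: "i \<in> {m<..n}"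
    have "expectation (\<lambda>\<omega>. ?f i (X 1 \<omega>)) = expectation (\<lambda>\<omega>. ?f i (X i \<omega>))"
      using i by (intro expectation_identical[symmetric]) auto
    also have "\<dots> = expectation (indicator {\<omega> \<in> space M. real i \<le> \<bar>X i \<omega>\<bar> powr q})"
      by (intro Bochner_Integration.integral_cong) (auto simp: indicator_def)
    finally show "prob {\<omega> \<in> space M. real i \<le> \<bar>X i \<omega>\<bar> powr q} = expectation (\<lambda>\<omega>. ?f i (X 1 \<omega>))"
      using m[OF i] by simp
  qed
  also have "\<dots> = expectation (\<lambda>\<omega>. \<Sum>i\<in>{m<..n}. ?f i (X 1 \<omega>))"
    using int by (intro Bochner_Integration.integral_sum[symmetric]) auto
  also have "\<dots> \<le> tail_moment m"
    unfolding tail_moment_def using int integrable_tail count_le_tail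
    by (intro integral_mono Bochner_Integration.integrable_sum) auto
  finally show ?thesis .
qed

definition truncated_mean :: "nat \<Rightarrow> real" where
  "truncated_mean i = expectation (\<lambda>\<omega>. truncate_power q i (X 1 \<omega>))"

lemma abs_truncate_power_le: "\<bar>truncate_power q i x\<bar> \<le> real i powr (1 / q)"
proof (cases "\<bar>x\<bar> powr q < real i")
  case True
  have "\<bar>x\<bar> = (\<bar>x\<bar> powr q) powr (1 / q)"
    using q by (simp add: powr_powr)
  also have "\<dots> \<le> real i powr (1 / q)"
    using True q by (intro powr_mono2) auto
  finally show ?thesis
    using True by (simp add: truncate_power_def)
qed (simp add: truncate_power_def)

lemma integrable_truncated: "integrable M (\<lambda>\<omega>. truncate_power q i (X 1 \<omega>))"
  by (rule integrable_const_bound[where B = "real i powr (1 / q)"]) (auto simp: abs_truncate_power_le)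

lemma integrable_truncated_square: "integrable M (\<lambda>\<omega>. (truncate_power q i (X 1 \<omega>))\<^sup>2)"
proof (rule integrable_const_bound)
  have "(truncate_power q i x)\<^sup>2 \<le> (real i powr (1 / q))\<^sup>2" for x
    using power_mono[OF abs_truncate_power_le[of i x], of 2] by simp
  then show "AE \<omega> in M. norm ((truncate_power q i (X 1 \<omega>))\<^sup>2) \<le> (real i powr (1 / q))\<^sup>2"
    by simp
qed measurable

text \<open>
  The mean of \<open>X 1\<close> is 0, so that truncated means are means of truncation errors. Such an error
  occurs only if \<open>\<bar>X 1\<bar> powr q \<ge> i\<close>, and then \<open>\<bar>X 1\<bar>\<close> is at most \<open>i powr (1 / q - 1)\<close> times its
  \<open>q\<close>-th power. Summing these weights gives the normalization \<open>n powr (1 / q)\<close>.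
\<close>

lemma truncated_mean_sum_le:
  assumes "1 \<le> m"
  shows "(\<Sum>i\<in>{m<..n}. \<bar>truncated_mean i\<bar>) \<le> q * tail_moment m * real n powr (1 / q)"
proof -
  note tail = tail_moment_nonneg[of m]
  have "\<bar>truncated_mean i\<bar> \<le> real i powr (1 / q - 1) * tail_moment m" if "i \<in> {m<..n}" for i
  proof -
    have "truncated_mean i = expectation (\<lambda>\<omega>. truncate_power q i (X 1 \<omega>) - X 1 \<omega>)"
      using integrable_truncated integrable_1 by (simp add: truncated_mean_def centered)
    also have "\<bar>\<dots>\<bar> \<le> expectation (\<lambda>\<omega>. \<bar>truncate_power q i (X 1 \<omega>) - X 1 \<omega>\<bar>)"
      by (rule integral_abs_bound)
    also have "\<dots> \<le> expectation (\<lambda>\<omega>. real i powr (1 / q - 1) *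
        (if real m \<le> \<bar>X 1 \<omega>\<bar> powr q then \<bar>X 1 \<omega>\<bar> powr q else 0))"
      using that integrable_truncated integrable_1 integrable_tail q truncate_power_error
      by (intro integral_mono integrable_mult_right integrable_abs Bochner_Integration.integrable_diff) auto
    finally show ?thesis
      by (simp add: tail_moment_def)
  qed
  then have "(\<Sum>i\<in>{m<..n}. \<bar>truncated_mean i\<bar>) \<le> (\<Sum>i\<in>{m<..n}. real i powr (1 / q - 1) * tail_moment m)"
    by (rule sum_mono)
  also have "\<dots> \<le> (\<Sum>i=1..n. real i powr (1 / q - 1) * tail_moment m)"
    using tail by (intro sum_mono2) auto
  also have "\<dots> = (\<Sum>i=1..n. real i powr (1 / q - 1)) * tail_moment m"
    by (simp add: sum_distrib_right)
  also have "\<dots> \<le> (real n powr (1 / q) / (1 / q)) * tail_moment m"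
    using q tail by (intro mult_right_mono sum_powr_le) auto
  finally show ?thesis
    by (simp add: mult_ac)
qed

text \<open>
  The variables whose sums enter Kronecker's lemma. The first \<open>m\<close> of them are set to 0 since the sum
  \<open>partial_sum X m\<close> is treated separately.
\<close>

definition normalized :: "nat \<Rightarrow> nat \<Rightarrow> 'a \<Rightarrow> real" where
  "normalized m i \<omega> =
    (if m < i then (truncate_power q i (X i \<omega>) - truncated_mean i) / real i powr (1 / q) else 0)"

text \<open>
  Kolmogorov's inequality, with variances bounded by second moments of the truncated variables. The
  constant is \<open>a / (a - 1)\<close> for \<open>a = 2 / q\<close>.
\<close>

lemma prob_normalized_sum_le:
  assumes m: "1 \<le> m" and K: "0 < K" "K \<le> real m" and \<epsilon>: "0 < \<epsilon>"
  shows "prob {\<omega> \<in> space M. \<exists>k\<le>n. \<epsilon> \<le> \<bar>\<Sum>i=1..k. normalized m i \<omega>\<bar>}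
     \<le> 2 / (2 - q) * (tail_moment K + (K / real m) powr (2 / q - 1) * moment) / \<epsilon>\<^sup>2"
proof -
  define h where "h i x = (if m < i then (truncate_power q i x - truncated_mean i) / real i powr (1 / q) else 0)"
    for i x
  have h[measurable]: "h i \<in> borel_measurable borel" for i
    unfolding h_def by measurable
  have norm_h: "normalized m i = (\<lambda>\<omega>. h i (X i \<omega>))" for i
    by (auto simp: normalized_def h_def)
  have int_h: "integrable M (\<lambda>\<omega>. h i (X 1 \<omega>))" for i
    using integrable_truncated by (cases "m < i") (auto simp: h_def)
  have int_h2: "integrable M (\<lambda>\<omega>. (h i (X 1 \<omega>))\<^sup>2)" for i
    using integrable_truncated integrable_truncated_square
    by (cases "m < i") (auto simp: h_def power_divide power2_diff)
  have mean_h: "expectation (\<lambda>\<omega>. h i (X 1 \<omega>)) = 0" for i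
    using integrable_truncated by (cases "m < i") (auto simp: h_def prob_space truncated_mean_def)
  have sq: "expectation (\<lambda>\<omega>. (h i (X 1 \<omega>))\<^sup>2)
      \<le> (if m < i then expectation (\<lambda>\<omega>. (truncate_power q i (X 1 \<omega>))\<^sup>2 * real i powr (- (2 / q))) else 0)" for i
  proof (cases "m < i")
    case True
    have "(real i powr (1 / q))\<^sup>2 = real i powr (2 / q)"
      by (simp add: power2_eq_square powr_add[symmetric])
    then have "(h i x)\<^sup>2 = (truncate_power q i x - truncated_mean i)\<^sup>2 * real i powr (- (2 / q))" for x
      using True by (simp add: h_def power_divide powr_minus_divide)
    then have "expectation (\<lambda>\<omega>. (h i (X 1 \<omega>))\<^sup>2) = 
        variance (\<lambda>\<omega>. truncate_power q i (X 1 \<omega>)) * real i powr (- (2 / q))"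
      by (simp add: truncated_mean_def)
    also have "variance (\<lambda>\<omega>. truncate_power q i (X 1 \<omega>)) \<le> expectation (\<lambda>\<omega>. (truncate_power q i (X 1 \<omega>))\<^sup>2)"
      using integrable_truncated integrable_truncated_square by (simp add: variance_eq)
    finally show ?thesis
      using True by (simp add: mult_right_mono)
  qed (simp add: h_def)
  have a: "2 / q / (2 / q - 1) = 2 / (2 - q)"
    using q by (simp add: field_simps)
  have "prob {\<omega> \<in> space M. \<exists>k\<le>n. \<epsilon> \<le> \<bar>\<Sum>i=1..k. normalized m i \<omega>\<bar>}
      \<le> (\<Sum>i=1..n. expectation (\<lambda>\<omega>. (normalized m i \<omega>)\<^sup>2)) / \<epsilon>\<^sup>2"
  proof (rule Kolmogorov_maximal_inequality[OF _ _ _ \<epsilon>])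
    show "indep_vars (\<lambda>_. borel) (normalized m) {1..n}"
      unfolding norm_h by (rule indep_vars_compose2[OF indep_vars_subset[OF indep]]) auto
    show "integrable M (\<lambda>\<omega>. (normalized m i \<omega>)\<^sup>2)" if "i \<in> {1..n}" for i
      using that int_h2 by (subst norm_h, subst integrable_identical[of "\<lambda>x. (h i x)\<^sup>2"]) auto
    show "expectation (normalized m i) = 0" if "i \<in> {1..n}" for i
      using that mean_h by (subst norm_h, subst expectation_identical[of "h i"]) auto
  qed
  also have "(\<Sum>i=1..n. expectation (\<lambda>\<omega>. (normalized m i \<omega>)\<^sup>2)) = (\<Sum>i=1..n. expectation (\<lambda>\<omega>. (h i (X 1 \<omega>))\<^sup>2))"
    unfolding norm_h by (intro sum.cong expectation_identical) auto
  also have "\<dots> \<le> (\<Sum>i=1..n. if m < i then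
      expectation (\<lambda>\<omega>. (truncate_power q i (X 1 \<omega>))\<^sup>2 * real i powr (- (2 / q))) else 0)"
    by (intro sum_mono sq)
  also have "\<dots> = (\<Sum>i\<in>{m<..n}. expectation (\<lambda>\<omega>. (truncate_power q i (X 1 \<omega>))\<^sup>2 * real i powr (- (2 / q))))"
    by (rule sum.mono_neutral_cong_right) auto
  also have "\<dots> = expectation (\<lambda>\<omega>. \<Sum>i\<in>{m<..n}. (truncate_power q i (X 1 \<omega>))\<^sup>2 * real i powr (- (2 / q)))"
    using integrable_truncated_square by (intro Bochner_Integration.integral_sum[symmetric]) auto
  also have "\<dots> \<le> expectation (\<lambda>\<omega>. 2 / (2 - q) * ((if K \<le> \<bar>X 1 \<omega>\<bar> powr q then \<bar>X 1 \<omega>\<bar> powr q else 0) +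
      (K / real m) powr (2 / q - 1) * (\<bar>X 1 \<omega>\<bar> powr q)))"
  proof (rule integral_mono)
    show "(\<Sum>i\<in>{m<..n}. (truncate_power q i (X 1 \<omega>))\<^sup>2 * real i powr (- (2 / q)))
      \<le> 2 / (2 - q) * ((if K \<le> \<bar>X 1 \<omega>\<bar> powr q then \<bar>X 1 \<omega>\<bar> powr q else 0) +
      (K / real m) powr (2 / q - 1) * (\<bar>X 1 \<omega>\<bar> powr q))" for \<omega>
    proof -
      have "0 < q" "1 < 2 / q"
        using q by auto
      then show ?thesis
        using truncated_square_sum_le[OF \<open>1 < 2 / q\<close> powr_ge_zero K m, of "\<bar>X 1 \<omega>\<bar>" q n]
        by (simp only: truncate_power_square a)
    qed
  qed (use integrable_truncated_square integrable_tail integrable_moment in auto)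
  also have "\<dots> = 2 / (2 - q) * (tail_moment K + (K / real m) powr (2 / q - 1) * moment)"
    using integrable_tail integrable_moment by (simp add: tail_moment_def moment_def)
  finally show ?thesis
    by (simp add: divide_right_mono)
qed

text \<open>
  Outside of three events, each of which accounts for one term of the bound, \<open>partial_sum X k\<close> is
  less than \<open>4 * \<epsilon> * k powr (1 / q)\<close> in absolute value. The first \<open>m\<close> summands contribute at most one
  \<open>\<epsilon>\<close>, by Markov's inequality and because \<open>N\<close> is large compared with \<open>m\<close>. The later summands agree
  with their truncations; of these, the centered parts contribute at most two by the inequalities of
  Kolmogorov and Kronecker, and the means contribute one by the assumption on \<open>tail_moment m\<close>.
\<close>

lemma maximal_deviation_finite:
  assumes m: "1 \<le> m" "m \<le> N" and K: "0 < K" "K \<le> real m" and \<epsilon>: "0 < \<epsilon>"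
    and small: "q * tail_moment m \<le> \<epsilon>"
  shows "prob {\<omega> \<in> space M. \<exists>k\<in>{N..n}. 4 * \<epsilon> \<le> \<bar>partial_sum X k \<omega>\<bar> / real k powr (1 / q)}
    \<le> real m * (1 + moment) / (\<epsilon> * real N powr (1 / q)) + tail_moment m
      + 2 / (2 - q) * (tail_moment K + (K / real m) powr (2 / q - 1) * moment) / \<epsilon>\<^sup>2"
proof -
  let ?A = "{\<omega> \<in> space M. \<epsilon> * real N powr (1 / q) \<le> \<bar>partial_sum X m \<omega>\<bar>}"
  let ?B = "{\<omega> \<in> space M. \<exists>i\<in>{m<..n}. real i \<le> \<bar>X i \<omega>\<bar> powr q}"
  let ?C = "{\<omega> \<in> space M. \<exists>k\<le>n. \<epsilon> \<le> \<bar>\<Sum>i=1..k. normalized m i \<omega>\<bar>}"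
  have X[measurable]: "random_variable borel (X i)" if "i \<in> {m<..n}" for i
    using that by (intro rv) auto
  have norm_rv[measurable]: "random_variable borel (normalized m i)" for i
    using rv[of i] unfolding normalized_def[abs_def] by (cases "m < i") auto
  have sets: "?A \<in> events" "?B \<in> events" "?C \<in> events"
    by measurable
  have "{\<omega> \<in> space M. \<exists>k\<in>{N..n}. 4 * \<epsilon> \<le> \<bar>partial_sum X k \<omega>\<bar> / real k powr (1 / q)} \<subseteq> ?A \<union> ?B \<union> ?C"
  proof (intro subsetI, rule ccontr)
    fix \<omega> assume \<omega>: "\<omega> \<in> {\<omega> \<in> space M. \<exists>k\<in>{N..n}. 4 * \<epsilon> \<le> \<bar>partial_sum X k \<omega>\<bar> / real k powr (1 / q)}"
      and not: "\<omega> \<notin> ?A \<union> ?B \<union> ?C"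
    then obtain k where k: "N \<le> k" "k \<le> n" "4 * \<epsilon> \<le> \<bar>partial_sum X k \<omega>\<bar> / real k powr (1 / q)"
      by auto
    have kpos: "0 < real k powr (1 / q)"
      using k m by simp
    have A: "\<bar>partial_sum X m \<omega>\<bar> < \<epsilon> * real N powr (1 / q)"
      and B: "\<And>i. i \<in> {m<..n} \<Longrightarrow> \<bar>X i \<omega>\<bar> powr q < real i"
      using \<omega> not by (auto simp: not_le)
    have C: "\<bar>\<Sum>i=1..k. normalized m i \<omega>\<bar> < \<epsilon>" if "k \<le> n" for k
    proof (rule ccontr)
      assume "\<not> ?thesis"
      with that \<omega> have "\<omega> \<in> ?C"
        by (auto simp: not_less)
      with not show False
        by blast
    qed
    let ?y = "\<lambda>i. truncate_power q i (X i \<omega>) - truncated_mean i"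
    have "(\<Sum>i=1..l. normalized m i \<omega>) = (\<Sum>i\<in>{m<..l}. ?y i / real i powr (1 / q))" for l
      by (rule sum.mono_neutral_cong_right) (auto simp: normalized_def)
    with C k have U: "\<bar>\<Sum>i\<in>{m<..l}. ?y i / real i powr (1 / q)\<bar> \<le> \<epsilon>" if "l \<le> k" for l
      using that by (metis le_trans less_imp_le)
    have "\<bar>\<Sum>i\<in>{m<..k}. ?y i\<bar> \<le> 2 * \<epsilon> * real k powr (1 / q)"
      by (rule Kronecker_bound[OF _ _ _ U]) (use q in \<open>auto intro!: monoI powr_mono2\<close>)
    moreover have "(\<Sum>i\<in>{m<..k}. X i \<omega>) = (\<Sum>i\<in>{m<..k}. ?y i) + (\<Sum>i\<in>{m<..k}. truncated_mean i)"
      unfolding sum.distrib[symmetric] using B k by (intro sum.cong) (auto simp: truncate_power_def)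
    moreover have "\<bar>\<Sum>i\<in>{m<..k}. truncated_mean i\<bar> \<le> \<epsilon> * real k powr (1 / q)"
    proof -
      have "\<bar>\<Sum>i\<in>{m<..k}. truncated_mean i\<bar> \<le> (\<Sum>i\<in>{m<..k}. \<bar>truncated_mean i\<bar>)"
        by (rule sum_abs)
      also have "\<dots> \<le> q * tail_moment m * real k powr (1 / q)"
        using m by (intro truncated_mean_sum_le) auto
      also have "\<dots> \<le> \<epsilon> * real k powr (1 / q)"
        using small by (intro mult_right_mono) auto
      finally show ?thesis .
    qed
    moreover have "partial_sum X k \<omega> = partial_sum X m \<omega> + (\<Sum>i\<in>{m<..k}. X i \<omega>)"
    proof -
      have "{1..k} = {1..m} \<union> {m<..k}" "{1..m} \<inter> {m<..k} = {}"
        using m k by auto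
      then show ?thesis
        unfolding partial_sum_def by (simp add: sum.union_disjoint)
    qed
    moreover have "\<epsilon> * real N powr (1 / q) \<le> \<epsilon> * real k powr (1 / q)"
      using \<epsilon> k q by (intro mult_left_mono powr_mono2) auto
    ultimately have "\<bar>partial_sum X k \<omega>\<bar> < 4 * \<epsilon> * real k powr (1 / q)"
      using A by linarith
    then show False
      using k(3) kpos by (simp add: field_simps)
  qed
  then have "prob {\<omega> \<in> space M. \<exists>k\<in>{N..n}. 4 * \<epsilon> \<le> \<bar>partial_sum X k \<omega>\<bar> / real k powr (1 / q)}
      \<le> prob (?A \<union> ?B \<union> ?C)"
    using sets by (intro finite_measure_mono) auto
  also have "\<dots> \<le> prob ?A + prob ?B + prob ?C"
    using sets by (intro order_trans[OF measure_Un_le] add_mono measure_Un_le) auto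
  also have "prob ?A \<le> real m * (1 + moment) / (\<epsilon> * real N powr (1 / q))"
  proof -
    have "prob ?A \<le> expectation (\<lambda>\<omega>. \<bar>partial_sum X m \<omega>\<bar>) / (\<epsilon> * real N powr (1 / q))"
      using \<epsilon> m expectation_abs_partial_sum_le[of m]
      by (intro integral_Markov_inequality_measure[where A = "{}"]) auto
    also have "\<dots> \<le> real m * (1 + moment) / (\<epsilon> * real N powr (1 / q))"
      using \<epsilon> expectation_abs_partial_sum_le[of m] by (intro divide_right_mono) auto
    finally show ?thesis .
  qed
  also note prob_exceeds_truncation_le
  also note prob_normalized_sum_le[OF m(1) K \<epsilon>]
  finally show ?thesis
    by simp
qed

end

context iid_centered_moment
begin

lemma maximal_deviation:
  assumes m: "1 \<le> m" "m \<le> N" and K: "0 < K" "K \<le> real m" and \<epsilon>: "0 < \<epsilon>"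
    and small: "q * tail_moment m \<le> \<epsilon>"
  shows "emeasure M (A_qdiv M X q N (4 * \<epsilon>))
    \<le> ennreal (real m * (1 + moment) / (\<epsilon> * real N powr (1 / q)) + tail_moment m
      + 2 / (2 - q) * (tail_moment K + (K / real m) powr (2 / q - 1) * moment) / \<epsilon>\<^sup>2)"
proof -
  let ?D = "\<lambda>n. {\<omega> \<in> space M. \<exists>k\<in>{N..n}. 4 * \<epsilon> \<le> \<bar>partial_sum X k \<omega>\<bar> / real k powr (1 / q)}"
  have "A_qdiv M X q N (4 * \<epsilon>) = (\<Union>n. ?D n)"
    by (auto simp: A_qdiv_iff) (meson atLeastAtMost_iff order_refl)
  also have "emeasure M \<dots> = (SUP n. emeasure M (?D n))"
    by (intro SUP_emeasure_incseq[symmetric]) (auto intro!: incseq_SucI)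
  also have "\<dots> \<le> ennreal (real m * (1 + moment) / (\<epsilon> * real N powr (1 / q)) + tail_moment m
      + 2 / (2 - q) * (tail_moment K + (K / real m) powr (2 / q - 1) * moment) / \<epsilon>\<^sup>2)"
    unfolding emeasure_eq_measure
    by (intro SUP_least ennreal_leI maximal_deviation_finite[OF m K \<epsilon> small])
  finally show ?thesis .
qed

lemma nn_integral_tail:
  "(\<integral>\<^sup>+\<omega>. ennreal (\<bar>X 1 \<omega>\<bar> powr q) * indicator {\<omega>'. x \<le> \<bar>X 1 \<omega>'\<bar> powr q} \<omega> \<partial>M) = ennreal (tail_moment x)"
proof -
  have "(\<integral>\<^sup>+\<omega>. ennreal (\<bar>X 1 \<omega>\<bar> powr q) * indicator {\<omega>'. x \<le> \<bar>X 1 \<omega>'\<bar> powr q} \<omega> \<partial>M)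
      = (\<integral>\<^sup>+\<omega>. ennreal (if x \<le> \<bar>X 1 \<omega>\<bar> powr q then \<bar>X 1 \<omega>\<bar> powr q else 0) \<partial>M)"
    by (intro nn_integral_cong) (auto simp: indicator_def)
  also have "\<dots> = ennreal (tail_moment x)"
    unfolding tail_moment_def by (intro nn_integral_eq_integral integrable_tail) auto
  finally show ?thesis .
qed

end

section \<open>Moments from deviation probabilities\<close>

text \<open>
  If \<open>z \<ge> 2 * m\<close>, then at least \<open>z / 2\<close> of the integers \<open>m, m + 1, \<dots>\<close> are at most \<open>z\<close>. In
  expectation, the tail of a moment is thus bounded by a sum of tail probabilities.
\<close>

lemma tail_le_twice_count:
  fixes z :: real
  assumes "0 \<le> z" "1 \<le> m"
  shows "ennreal z * indicator {z. 2 * real m \<le> z} z \<le> 2 * (\<Sum>k. indicator {z. real (m + k) \<le> z} z)"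
proof (cases "2 * real m \<le> z")
  case True
  let ?n = "Suc (nat \<lfloor>z\<rfloor>) - m"
  have z: "real (nat \<lfloor>z\<rfloor>) \<le> z" "z < real (nat \<lfloor>z\<rfloor>) + 1"
    using assms(1) by linarith+
  have "m \<le> nat \<lfloor>z\<rfloor>"
    using True by (intro le_nat_floor) linarith
  then have "real ?n = real (nat \<lfloor>z\<rfloor>) + 1 - real m"
    by (simp add: of_nat_diff)
  with z True have n: "z / 2 \<le> real ?n"
    by linarith
  have "ennreal z = 2 * ennreal (z / 2)"
    using ennreal_mult[of 2 "z / 2"] assms(1) by simp
  also have "ennreal (z / 2) \<le> ennreal (real ?n)"
    using n by (rule ennreal_leI)
  also have "ennreal (real ?n) = (\<Sum>k<?n. indicator {z. real (m + k) \<le> z} z)"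
  proof -
    have "real (m + k) \<le> z" if "k < ?n" for k
    proof -
      have "m + k \<le> nat \<lfloor>z\<rfloor>"
        using that by simp
      then have "real (m + k) \<le> real (nat \<lfloor>z\<rfloor>)"
        by (simp only: of_nat_le_iff)
      with z show ?thesis
        by simp
    qed
    then have "(\<Sum>k<?n. indicator {z. real (m + k) \<le> z} z) = (\<Sum>k<?n. 1::ennreal)"
      by (intro sum.cong) (auto simp: indicator_def)
    then show ?thesis
      by (simp add: ennreal_of_nat_eq_real_of_nat)
  qed
  also have "\<dots> \<le> (\<Sum>k. indicator {z. real (m + k) \<le> z} z)"
    by (intro sum_le_suminf) auto
  finally show ?thesis
    using True by (simp add: mult_left_mono)
qed simp

context iid_process
begin

text \<open>
  \<open>X k\<close> is the difference of two partial sums. If both ratios are below \<open>1 / 2\<close>, then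
  \<open>\<bar>X k\<bar> powr q < k\<close>; so off the deviation event this holds for all \<open>k > m\<close>. By independence, the
  probability that it does for \<open>m < k \<le> n\<close> is at most \<open>exp (- s)\<close>, where \<open>s\<close> is the sum on the
  left; it is at least \<open>1 - \<delta>\<close>. This is a quantitative form of the second Borel--Cantelli lemma.
\<close>

lemma tail_prob_sum_le:
  assumes m: "1 \<le> m" and q: "1 \<le> q" and \<delta>: "\<delta> \<le> 1 / 2"
    and dev: "prob (A_qdiv M X q m (1 / 2)) \<le> \<delta>"
  shows "(\<Sum>k\<in>{Suc m..n}. prob {\<omega> \<in> space M. real k \<le> \<bar>X 1 \<omega>\<bar> powr q}) \<le> 2 * \<delta>"
proof (cases "Suc m \<le> n")
  case False
  have "0 \<le> \<delta>"
    using dev measure_nonneg order_trans by blast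
  with False show ?thesis
    by simp
next
  case True
  let ?I = "{Suc m..n}"
  define p where "p k = prob {\<omega> \<in> space M. real k \<le> \<bar>X 1 \<omega>\<bar> powr q}" for k
  define s where "s = (\<Sum>k\<in>?I. p k)"
  have dev_sets: "A_qdiv M X q m (1 / 2) \<in> events"
    unfolding A_qdiv_def by measurable
  have compl: "prob (X k -` {x. \<bar>x\<bar> powr q < real k} \<inter> space M) = 1 - p k" if k: "k \<in> ?I" for k
  proof -
    have [measurable]: "random_variable borel (X k)"
      using k by (intro rv) simp
    have "X k -` {x. \<bar>x\<bar> powr q < real k} \<inter> space M = space M - {\<omega> \<in> space M. X k \<omega> \<in> {x. real k \<le> \<bar>x\<bar> powr q}}"
      by auto
    also have "prob \<dots> = 1 - prob {\<omega> \<in> space M. X k \<omega> \<in> {x. real k \<le> \<bar>x\<bar> powr q}}"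
      by (rule prob_compl) measurable
    also have "prob {\<omega> \<in> space M. X k \<omega> \<in> {x. real k \<le> \<bar>x\<bar> powr q}} = p k"
      using k by (subst prob_identical) (auto simp: p_def)
    finally show ?thesis .
  qed
  have "1 - \<delta> \<le> prob (space M - A_qdiv M X q m (1 / 2))"
    using dev dev_sets by (simp add: prob_compl)
  also have "\<dots> \<le> prob (\<Inter>k\<in>?I. X k -` {x. \<bar>x\<bar> powr q < real k} \<inter> space M)"
  proof (rule finite_measure_mono)
    show "space M - A_qdiv M X q m (1 / 2) \<subseteq> (\<Inter>k\<in>?I. X k -` {x. \<bar>x\<bar> powr q < real k} \<inter> space M)"
    proof (intro subsetI INT_I IntI vimageI2 CollectI)
      fix \<omega> k assume \<omega>: "\<omega> \<in> space M - A_qdiv M X q m (1 / 2)" and k: "k \<in> ?I"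
      have small: "\<bar>partial_sum X l \<omega>\<bar> < real k powr (1 / q) / 2" if "l \<in> {k - 1, k}" for l
      proof -
        have "m \<le> l" "l \<le> k"
          using that k by auto
        with \<omega> have "\<bar>partial_sum X l \<omega>\<bar> / real l powr (1 / q) < 1 / 2"
          by (metis A_qdiv_iff DiffE not_le)
        then have "\<bar>partial_sum X l \<omega>\<bar> < real l powr (1 / q) / 2"
          using \<open>m \<le> l\<close> m by (simp add: field_simps)
        also have "\<dots> \<le> real k powr (1 / q) / 2"
          using \<open>l \<le> k\<close> q by (intro divide_right_mono powr_mono2) auto
        finally show ?thesis .
      qed
      obtain l where l: "k = Suc l"
        using k by (cases k) auto
      have "X k \<omega> = partial_sum X k \<omega> - partial_sum X (k - 1) \<omega>"
        by (simp add: l partial_sum_def)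
      then have "\<bar>X k \<omega>\<bar> < real k powr (1 / q)"
        using small[of k] small[of "k - 1"] by simp
      then have "\<bar>X k \<omega>\<bar> powr q < (real k powr (1 / q)) powr q"
        using q by (intro powr_less_mono2) auto
      also have "\<dots> = real k"
        using q by (simp add: powr_powr)
      finally show "\<bar>X k \<omega>\<bar> powr q < real k" .
    qed auto
    have "X k -` {x. \<bar>x\<bar> powr q < real k} \<inter> space M \<in> events" if "k \<in> ?I" for k
      using that by (intro measurable_sets[OF rv]) auto
    then show "(\<Inter>k\<in>?I. X k -` {x. \<bar>x\<bar> powr q < real k} \<inter> space M) \<in> events"
      using True by (intro sets.finite_INT) auto
  qed
  also have "\<dots> = (\<Prod>k\<in>?I. prob (X k -` {x. \<bar>x\<bar> powr q < real k} \<inter> space M))"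
    using True by (intro indep_varsD[OF indep]) auto
  also have "\<dots> = (\<Prod>k\<in>?I. 1 - p k)"
    by (intro prod.cong refl compl)
  also have "\<dots> \<le> (\<Prod>k\<in>?I. exp (- p k))"
  proof (intro prod_mono conjI)
    show "0 \<le> 1 - p k" for k
      by (simp add: p_def)
    show "1 - p k \<le> exp (- p k)" for k
      using exp_ge_add_one_self[of "- p k"] by simp
  qed
  also have "\<dots> = exp (- s)"
    by (simp add: s_def exp_sum sum_negf[symmetric])
  finally have "1 - \<delta> \<le> exp (- s)" .
  moreover have "0 \<le> s"
    unfolding s_def p_def by (intro sum_nonneg) auto
  then have "(1 + s) * exp (- s) \<le> 1"
    using exp_ge_add_one_self[of s] by (simp add: exp_minus field_simps)
  ultimately have "(1 + s) * (1 - \<delta>) \<le> 1"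
    using \<open>0 \<le> s\<close> mult_left_mono[of "1 - \<delta>" "exp (- s)" "1 + s"] by linarith
  moreover have "s * (1 / 2) \<le> s * (1 - \<delta>)"
    using \<open>0 \<le> s\<close> \<delta> by (intro mult_left_mono) auto
  ultimately have "s \<le> 2 * \<delta>"
    by (simp add: algebra_simps)
  then show ?thesis
    by (simp add: s_def p_def)
qed

lemma tail_moment_le_of_deviation:
  assumes m: "1 \<le> m" and q: "1 \<le> q" and \<delta>: "\<delta> \<le> 1 / 2"
    and dev: "prob (A_qdiv M X q m (1 / 2)) \<le> \<delta>" and x: "2 * real (Suc m) \<le> x"
  shows "(\<integral>\<^sup>+\<omega>. ennreal (\<bar>X 1 \<omega>\<bar> powr q) * indicator {\<omega>'. x \<le> \<bar>X 1 \<omega>'\<bar> powr q} \<omega> \<partial>M) \<le> ennreal (4 * \<delta>)"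
proof -
  let ?z = "\<lambda>\<omega>. \<bar>X 1 \<omega>\<bar> powr q"
  have "0 \<le> \<delta>"
    using dev measure_nonneg order_trans by blast
  have "(\<integral>\<^sup>+\<omega>. ennreal (?z \<omega>) * indicator {\<omega>'. x \<le> ?z \<omega>'} \<omega> \<partial>M)
      \<le> (\<integral>\<^sup>+\<omega>. 2 * (\<Sum>k. indicator {z. real (Suc m + k) \<le> z} (?z \<omega>)) \<partial>M)"
  proof (rule nn_integral_mono)
    fix \<omega>
    have "ennreal (?z \<omega>) * indicator {\<omega>'. x \<le> ?z \<omega>'} \<omega> \<le> ennreal (?z \<omega>) * indicator {z. 2 * real (Suc m) \<le> z} (?z \<omega>)"
      using x by (intro mult_left_mono) (auto simp: indicator_def)
    also have "\<dots> \<le> 2 * (\<Sum>k. indicator {z. real (Suc m + k) \<le> z} (?z \<omega>))"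
      by (rule tail_le_twice_count) auto
    finally show "ennreal (?z \<omega>) * indicator {\<omega>'. x \<le> ?z \<omega>'} \<omega>
        \<le> 2 * (\<Sum>k. indicator {z. real (Suc m + k) \<le> z} (?z \<omega>))" .
  qed
  also have "\<dots> = 2 * (\<Sum>k. \<integral>\<^sup>+\<omega>. indicator {z. real (Suc m + k) \<le> z} (?z \<omega>) \<partial>M)"
    by (subst nn_integral_cmult, measurable, subst nn_integral_suminf, measurable)
  also have "(\<Sum>k. \<integral>\<^sup>+\<omega>. indicator {z. real (Suc m + k) \<le> z} (?z \<omega>) \<partial>M)
      = (\<Sum>k. ennreal (prob {\<omega> \<in> space M. real (Suc m + k) \<le> ?z \<omega>}))"
  proof (rule arg_cong[where f = suminf], rule ext)
    fix k
    have "(\<integral>\<^sup>+\<omega>. indicator {z. real (Suc m + k) \<le> z} (?z \<omega>) \<partial>M)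
        = (\<integral>\<^sup>+\<omega>. indicator {\<omega> \<in> space M. real (Suc m + k) \<le> ?z \<omega>} \<omega> \<partial>M)"
      by (intro nn_integral_cong) (auto simp: indicator_def)
    then show "(\<integral>\<^sup>+\<omega>. indicator {z. real (Suc m + k) \<le> z} (?z \<omega>) \<partial>M)
        = ennreal (prob {\<omega> \<in> space M. real (Suc m + k) \<le> ?z \<omega>})"
      by (simp add: emeasure_eq_measure)
  qed
  also have "\<dots> \<le> ennreal (2 * \<delta>)"
  proof (rule suminf_le_const)
    fix n
    have "(\<Sum>k<n. ennreal (prob {\<omega> \<in> space M. real (Suc m + k) \<le> ?z \<omega>}))
        = ennreal (\<Sum>k<n. prob {\<omega> \<in> space M. real (Suc m + k) \<le> ?z \<omega>})"
      by (intro sum_ennreal) auto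
    also have "(\<Sum>k<n. prob {\<omega> \<in> space M. real (Suc m + k) \<le> ?z \<omega>})
        = (\<Sum>k\<in>{Suc m..m + n}. prob {\<omega> \<in> space M. real k \<le> ?z \<omega>})"
      by (rule sum.reindex_bij_witness[of _ "\<lambda>k. k - Suc m" "\<lambda>k. Suc m + k"]) auto
    also have "\<dots> \<le> 2 * \<delta>"
      by (rule tail_prob_sum_le[OF m q \<delta> dev])
    finally show "(\<Sum>k<n. ennreal (prob {\<omega> \<in> space M. real (Suc m + k) \<le> ?z \<omega>})) \<le> ennreal (2 * \<delta>)"
      by (simp add: ennreal_leI)
  qed auto
  finally have "(\<integral>\<^sup>+\<omega>. ennreal (?z \<omega>) * indicator {\<omega>'. x \<le> ?z \<omega>'} \<omega> \<partial>M) \<le> 2 * ennreal (2 * \<delta>)"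
    by (simp add: mult_left_mono)
  also have "\<dots> = ennreal (4 * \<delta>)"
    using \<open>0 \<le> \<delta>\<close> ennreal_mult[of 2 "2 * \<delta>"] by simp
  finally show ?thesis .
qed

end

section \<open>Uniform integrability and the uniform strong law\<close>

locale iid_family = random_sequence_family +
  fixes q :: real
  assumes q: "1 \<le> q" "q < 2"
    and iid: "\<And>P. P \<in> \<P> \<Longrightarrow> iid_sequence P X"
begin

lemma A_qdiv_cong: "P \<in> \<P> \<Longrightarrow> A_qdiv P X q m \<epsilon> = A_qdiv M X q m \<epsilon>"
  by (simp add: A_qdiv_def space_eq)

lemma iid_process: "P \<in> \<P> \<Longrightarrow> iid_process P X"
  using prob iid by (simp add: iid_process_def iid_process_axioms_def)

lemma uniformly_integrable_if_uniform_SLLN: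
  assumes "uniform_SLLN \<P> X q"
  shows "uniformly_integrable_moment \<P> q (X 1)"
  unfolding uniformly_integrable_moment_def SUP_tendsto_0_iff
proof (intro allI impI)
  fix \<delta> :: real assume \<delta>: "0 < \<delta>"
  let ?\<delta> = "min (\<delta> / 4) (1 / 2)"
  have "\<forall>\<^sub>F m in sequentially. \<forall>P\<in>\<P>. emeasure P (A_qdiv M X q m (1 / 2)) \<le> ennreal ?\<delta>"
    using \<delta> by (intro assms[unfolded uniform_SLLN_iff, rule_format]) auto
  then have "\<forall>\<^sub>F m in sequentially. 1 \<le> m \<and> (\<forall>P\<in>\<P>. emeasure P (A_qdiv M X q m (1 / 2)) \<le> ennreal ?\<delta>)"
    by (intro eventually_conj eventually_ge_at_top)
  then obtain m where m: "1 \<le> m" "\<And>P. P \<in> \<P> \<Longrightarrow> emeasure P (A_qdiv M X q m (1 / 2)) \<le> ennreal ?\<delta>"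
    by (auto simp: eventually_sequentially)
  show "\<forall>\<^sub>F x in at_top. \<forall>P\<in>\<P>.
      (\<integral>\<^sup>+\<omega>. ennreal (\<bar>X 1 \<omega>\<bar> powr q) * indicator {\<omega>'. x \<le> \<bar>X 1 \<omega>'\<bar> powr q} \<omega> \<partial>P) \<le> ennreal \<delta>"
    using eventually_ge_at_top[of "2 * real (Suc m)"]
  proof (eventually_elim, intro ballI)
    fix x P assume x: "2 * real (Suc m) \<le> x" and P: "P \<in> \<P>"
    interpret iid_process P X
      by (rule iid_process[OF P])
    have "prob (A_qdiv P X q m (1 / 2)) \<le> ?\<delta>"
      using m(2)[OF P] \<delta> by (simp add: A_qdiv_cong[OF P] emeasure_eq_measure)
    then have "(\<integral>\<^sup>+\<omega>. ennreal (\<bar>X 1 \<omega>\<bar> powr q) * indicator {\<omega>'. x \<le> \<bar>X 1 \<omega>'\<bar> powr q} \<omega> \<partial>P) \<le> ennreal (4 * ?\<delta>)"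
      by (intro tail_moment_le_of_deviation[OF m(1) q(1) _ _ x]) auto
    also have "\<dots> \<le> ennreal \<delta>"
      by (intro ennreal_leI) auto
    finally show "(\<integral>\<^sup>+\<omega>. ennreal (\<bar>X 1 \<omega>\<bar> powr q) * indicator {\<omega>'. x \<le> \<bar>X 1 \<omega>'\<bar> powr q} \<omega> \<partial>P) \<le> ennreal \<delta>" .
  qed
qed

text \<open>
  The parameters of \<open>maximal_deviation\<close> are chosen in the order \<open>K\<close>, \<open>m\<close>, \<open>N\<close>: first \<open>K\<close> makes
  the tail moments small, then \<open>m\<close> makes the variance contributed by values below \<open>K\<close> small, and
  finally \<open>N\<close> makes the first \<open>m\<close> summands negligible. Each choice uses only a bound \<open>B\<close> for the
  \<open>q\<close>-th moments and the rate of uniform integrability, which are common to all \<open>P\<close>.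
\<close>

lemma uniform_SLLN_if_uniformly_integrable:
  assumes centered: "\<And>P. P \<in> \<P> \<Longrightarrow> prob_space.expectation P (X 1) = 0"
    and UI: "uniformly_integrable_moment \<P> q (X 1)"
  shows "uniform_SLLN \<P> X q"
  unfolding uniform_SLLN_iff
proof (intro allI impI)
  let ?I = "\<lambda>P x. \<integral>\<^sup>+\<omega>. ennreal (\<bar>X 1 \<omega>\<bar> powr q) * indicator {\<omega>'. x \<le> \<bar>X 1 \<omega>'\<bar> powr q} \<omega> \<partial>P"
  have tail: "\<forall>\<^sub>F x in at_top. \<forall>P\<in>\<P>. ?I P x \<le> ennreal \<delta>" if "0 < \<delta>" for \<delta>
    using UI that unfolding uniformly_integrable_moment_def SUP_tendsto_0_iff by blast
  obtain x0 where x0: "\<And>P. P \<in> \<P> \<Longrightarrow> ?I P x0 \<le> ennreal 1"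
    using tail[of 1] by (auto simp: eventually_at_top_linorder)
  define B where "B = \<bar>x0\<bar> + 1"
  have "0 \<le> B"
    by (simp add: B_def)
  have int: "integrable P (\<lambda>\<omega>. \<bar>X 1 \<omega>\<bar> powr q)"
    and moment_le: "(\<integral>\<omega>. \<bar>X 1 \<omega>\<bar> powr q \<partial>P) \<le> B" if P: "P \<in> \<P>" for P
  proof -
    interpret iid_process P X
      by (rule iid_process[OF P])
    have "(\<integral>\<^sup>+\<omega>. ennreal (\<bar>X 1 \<omega>\<bar> powr q) \<partial>P)
        \<le> (\<integral>\<^sup>+\<omega>. ennreal \<bar>x0\<bar> + ennreal (\<bar>X 1 \<omega>\<bar> powr q) * indicator {\<omega>'. x0 \<le> \<bar>X 1 \<omega>'\<bar> powr q} \<omega> \<partial>P)"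
      by (intro nn_integral_mono) (auto simp: indicator_def not_le intro!: ennreal_leI)
    also have "\<dots> = ennreal \<bar>x0\<bar> + ?I P x0"
      by (subst nn_integral_add) (auto simp: emeasure_space_1)
    also have "\<dots> \<le> ennreal \<bar>x0\<bar> + ennreal 1"
      using x0[OF P] by (rule add_left_mono)
    also have "\<dots> = ennreal B"
      unfolding B_def by (rule ennreal_plus[symmetric]) auto
    finally have le: "(\<integral>\<^sup>+\<omega>. ennreal (\<bar>X 1 \<omega>\<bar> powr q) \<partial>P) \<le> ennreal B" .
    show int: "integrable P (\<lambda>\<omega>. \<bar>X 1 \<omega>\<bar> powr q)"
      using le_less_trans[OF le ennreal_less_top] by (intro integrableI_nonneg) auto
    have "ennreal (\<integral>\<omega>. \<bar>X 1 \<omega>\<bar> powr q \<partial>P) \<le> ennreal B"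
      using le nn_integral_eq_integral[OF int] by simp
    then show "(\<integral>\<omega>. \<bar>X 1 \<omega>\<bar> powr q \<partial>P) \<le> B"
      by (simp add: ennreal_le_iff[OF \<open>0 \<le> B\<close>])
  qed
  have loc: "iid_centered_moment P X q" if P: "P \<in> \<P>" for P
    using iid_process[OF P] q int[OF P] centered[OF P]
    by (simp add: iid_centered_moment_def iid_centered_moment_axioms_def)
  fix \<epsilon>' \<delta> :: real assume \<epsilon>': "0 < \<epsilon>'" and \<delta>: "0 < \<delta>"
  define \<epsilon> where "\<epsilon> = \<epsilon>' / 4"
  have \<epsilon>: "0 < \<epsilon>" "\<epsilon>' = 4 * \<epsilon>"
    using \<epsilon>' by (auto simp: \<epsilon>_def)
  define C where "C = 2 / (2 - q)"
  have C: "0 < C"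
    using q by (simp add: C_def)
  \<comment> \<open>Each of the four terms of the deviation bound receives a share of \<open>\<delta> / 4\<close>; the bound \<open>\<epsilon> / q\<close> is the assumption of \<open>maximal_deviation\<close>.\<close>
  define \<eta> where "\<eta> = min (\<epsilon> / q) (min (\<delta> / 4) (\<delta> * \<epsilon>\<^sup>2 / (4 * C)))"
  have \<eta>: "0 < \<eta>" "q * \<eta> \<le> \<epsilon>" "\<eta> \<le> \<delta> / 4" "C * \<eta> / \<epsilon>\<^sup>2 \<le> \<delta> / 4"
  proof -
    show "0 < \<eta>"
      using \<epsilon> \<delta> C q by (simp add: \<eta>_def)
    have "\<eta> \<le> \<epsilon> / q" "\<eta> \<le> \<delta> * \<epsilon>\<^sup>2 / (4 * C)"
      by (auto simp: \<eta>_def)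
    then show "q * \<eta> \<le> \<epsilon>" "C * \<eta> / \<epsilon>\<^sup>2 \<le> \<delta> / 4"
      using \<epsilon> C q by (auto simp: field_simps)
    show "\<eta> \<le> \<delta> / 4"
      unfolding \<eta>_def by (rule min.coboundedI2[OF min.cobounded1])
  qed
  obtain x1 where x1: "\<And>x P. x1 \<le> x \<Longrightarrow> P \<in> \<P> \<Longrightarrow> ?I P x \<le> ennreal \<eta>"
    using tail[OF \<eta>(1)] by (auto simp: eventually_at_top_linorder)
  define K where "K = max x1 1"
  have lim: "(\<lambda>n. c * (d / real n) powr r) \<longlonglongrightarrow> 0" if "0 < r" "0 \<le> d" for c d r :: real
  proof -
    have "(\<lambda>n. d / real n) \<longlonglongrightarrow> 0"
      by (rule lim_const_over_n)
    then have "(\<lambda>n. (d / real n) powr r) \<longlonglongrightarrow> 0"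
      using that by (intro tendsto_zero_powrI[where b = r]) auto
    then show ?thesis
      by (rule tendsto_mult_right_zero)
  qed
  have "(\<lambda>m. C * B / \<epsilon>\<^sup>2 * (K / real m) powr (2 / q - 1)) \<longlonglongrightarrow> 0"
    using q by (intro lim) (auto simp: K_def)
  then have "\<forall>\<^sub>F m in sequentially. C * B / \<epsilon>\<^sup>2 * (K / real m) powr (2 / q - 1) < \<delta> / 4"
    using \<delta> by (intro order_tendstoD) auto
  then have "\<forall>\<^sub>F m in sequentially. C * B / \<epsilon>\<^sup>2 * (K / real m) powr (2 / q - 1) < \<delta> / 4 \<and> nat \<lceil>K\<rceil> \<le> m"
    by (intro eventually_conj eventually_ge_at_top)
  then obtain m where m: "C * B / \<epsilon>\<^sup>2 * (K / real m) powr (2 / q - 1) < \<delta> / 4" "nat \<lceil>K\<rceil> \<le> m"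
    by (auto simp: eventually_sequentially)
  have K: "x1 \<le> K" "0 < K" "K \<le> real m" "1 \<le> m"
  proof -
    show "x1 \<le> K" "0 < K"
      by (auto simp: K_def)
    show "K \<le> real m"
      using m(2) by linarith
    moreover have "1 \<le> K"
      by (simp add: K_def)
    ultimately show "1 \<le> m"
      by linarith
  qed
  have "(\<lambda>N. real m * (1 + B) / \<epsilon> * (1 / real N) powr (1 / q)) \<longlonglongrightarrow> 0"
    using q by (intro lim) auto
  then have "\<forall>\<^sub>F N in sequentially. real m * (1 + B) / \<epsilon> * (1 / real N) powr (1 / q) < \<delta> / 4"
    using \<delta> by (intro order_tendstoD) auto
  moreover have "\<forall>\<^sub>F N in sequentially. m \<le> N"
    by (rule eventually_ge_at_top)
  ultimately show "\<forall>\<^sub>F N in sequentially. \<forall>P\<in>\<P>. emeasure P (A_qdiv M X q N \<epsilon>') \<le> ennreal \<delta>"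
  proof (eventually_elim, intro ballI)
    fix N P
    assume N: "real m * (1 + B) / \<epsilon> * (1 / real N) powr (1 / q) < \<delta> / 4" "m \<le> N" and P: "P \<in> \<P>"
    interpret iid_centered_moment P X q
      by (rule loc[OF P])
    have tail_le: "tail_moment x \<le> \<eta>" if "x1 \<le> x" for x
      using x1[OF that P] \<eta>(1) by (simp add: nn_integral_tail)
    have mom: "moment \<le> B"
      using moment_le[OF P] by (simp add: moment_def)
    have small: "q * tail_moment m \<le> \<epsilon>"
    proof -
      have "q * tail_moment m \<le> q * \<eta>"
        using tail_le[of m] K q by (intro mult_left_mono) auto
      with \<eta> show ?thesis
        by simp
    qed
    have "real m * (1 + moment) / (\<epsilon> * real N powr (1 / q)) \<le> real m * (1 + B) / (\<epsilon> * real N powr (1 / q))"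
      using mom \<epsilon> by (intro divide_right_mono mult_left_mono) auto
    also have "\<dots> = real m * (1 + B) / \<epsilon> * (1 / real N) powr (1 / q)"
      by (simp add: powr_divide)
    finally have 1: "real m * (1 + moment) / (\<epsilon> * real N powr (1 / q)) \<le> \<delta> / 4"
      using N(1) by (rule order_trans[OF _ less_imp_le])
    have 2: "tail_moment m \<le> \<delta> / 4"
      using tail_le[of m] K \<eta> by simp
    have "C * (tail_moment K + (K / real m) powr (2 / q - 1) * moment) / \<epsilon>\<^sup>2
        \<le> C * (\<eta> + (K / real m) powr (2 / q - 1) * B) / \<epsilon>\<^sup>2"
      using C mom tail_le[of K] K by (intro divide_right_mono mult_left_mono add_mono) auto
    also have "\<dots> = C * \<eta> / \<epsilon>\<^sup>2 + C * B / \<epsilon>\<^sup>2 * (K / real m) powr (2 / q - 1)"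
      by (simp add: algebra_simps add_divide_distrib)
    finally have 3: "C * (tail_moment K + (K / real m) powr (2 / q - 1) * moment) / \<epsilon>\<^sup>2 \<le> \<delta> / 4 + \<delta> / 4"
      using \<eta> m by linarith
    have "emeasure P (A_qdiv P X q N (4 * \<epsilon>)) \<le> ennreal (real m * (1 + moment) / (\<epsilon> * real N powr (1 / q)) + tail_moment m
      + 2 / (2 - q) * (tail_moment K + (K / real m) powr (2 / q - 1) * moment) / \<epsilon>\<^sup>2)"
      by (rule maximal_deviation[OF K(4) N(2) K(2,3) \<epsilon>(1) small])
    also have "\<dots> \<le> ennreal \<delta>"
      using 1 2 3[unfolded C_def] by (intro ennreal_leI) linarith
    finally show "emeasure P (A_qdiv M X q N \<epsilon>') \<le> ennreal \<delta>"
      by (simp add: A_qdiv_cong[OF P] \<epsilon>(2))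
  qed
qed

end

theorem corollary5p5:
  fixes M :: "'a measure" and X :: "nat \<Rightarrow> 'a \<Rightarrow> real" and q :: real
    and \<P> :: "'a measure set"
  assumes X: "\<And>n. n \<ge> 1 \<Longrightarrow> X n \<in> borel_measurable M"
    and q: "1 \<le> q" "q < 2"
    and prob: "\<And>P. P \<in> \<P> \<Longrightarrow> prob_space P"
    and sets: "\<And>P. P \<in> \<P> \<Longrightarrow> sets P = sets M"
    and iid: "\<And>P. P \<in> \<P> \<Longrightarrow> iid_sequence P X"
    and integrable: "\<And>P n. P \<in> \<P> \<Longrightarrow> n \<ge> 1 \<Longrightarrow> integrable P (X n)"
    and centered: "\<And>P. P \<in> \<P> \<Longrightarrow> prob_space.expectation P (X 1) = 0"
  shows "(uniformly_integrable_moment \<P> q (X 1) \<longleftrightarrow> uniform_SLLN \<P> X q) \<and>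
         (uniform_SLLN \<P> X q \<longleftrightarrow>
           (\<exists>E. e_process \<P> (natural_filtration M X) E \<and>
                diverges_tail_uniformly E (A_qdiv M X q)))"
proof -
  interpret iid_family M X \<P> q
    by (intro iid_family.intro random_sequence_family.intro iid_family_axioms.intro)
      (fact X prob sets q iid)+
  show ?thesis
    using uniform_SLLN_if_uniformly_integrable[OF centered] uniformly_integrable_if_uniform_SLLN
      uniform_SLLN_if_diverging_e_process diverging_e_process_if_uniform_SLLN
    by blast
qed

end
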